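(* Let $s \geq 2$ be an integer, and let $(\omega_i)_{i\geq 0}$ be i.i.d. real random variables with $\mathbb{E}[\exp(\beta\omega_1)] < \infty$ for all $\beta > 0$. For every $\beta > 0$, one has $h_c(\beta) = h_c(0) = 0$.
   Context: This is the hierarchical pinning model with parameters $b = s$, where $s \geq 2$ is an integer. Let $(\omega_i)_{i \geq 0}$ be i.i.d. real random variables with law $\mathbb{P}$ (expectation $\mathbb{E}$) such that $M(\beta) := \mathbb{E}[\exp(\beta \omega_1)] < \infty$ for all $\beta > 0$ (and $M(0)=1$). For $\beta \geq 0$ and $h \in \mathbb{R}$, define random variables $R_n^{(i)}$, $n, i \in \{0,1,2,\dots\}$, by $$R_0^{(i)} = \exp(\beta \omega_i + h - \log M(\beta)), \qquad R_{n+1}^{(i)} = \frac{\prod_{j=1}^s R_n^{(si+j)} + s - 1}{s}.$$ The free energy is $F(\beta,h) := \lim_{n \to \infty} \frac{1}{s^n} \log R_n^{(1)}$; this limit exists $\mathbb{P}$-almost surely and in $L^1(\mathbb{P})$, and is almost surely constant and non-negative. The critical point is $h_c(\beta) := \inf\{h \in \mathbb{R} : F(\beta,h) > 0\}$. *)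

theory Defs
  imports "HOL-Probability.Probability"
begin

definition exp_moment :: "'a measure \<Rightarrow> (nat \<Rightarrow> 'a \<Rightarrow> real) \<Rightarrow> real \<Rightarrow> real" where
  "exp_moment P \<omega> \<beta> = (\<integral>x. exp (\<beta> * \<omega> 1 x) \<partial>P)"

primrec partition_fun ::
  "'a measure \<Rightarrow> (nat \<Rightarrow> 'a \<Rightarrow> real) \<Rightarrow> nat \<Rightarrow> real \<Rightarrow> real \<Rightarrow> nat \<Rightarrow> nat \<Rightarrow> 'a \<Rightarrow> real" where
  "partition_fun P \<omega> s \<beta> h 0 i x = exp (\<beta> * \<omega> i x + h - ln (exp_moment P \<omega> \<beta>))"
| "partition_fun P \<omega> s \<beta> h (Suc n) i x =
     ((\<Prod>j=1..s. partition_fun P \<omega> s \<beta> h n (s * i + j) x) + real s - 1) / real s"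

text \<open>The limit defining the free energy is a random variable that is almost surely constant;
  the free energy is that constant. It is unique on a probability space, so the description
  below is meaningful whenever the limit exists almost surely and is almost surely constant.\<close>

definition free_energy ::
  "'a measure \<Rightarrow> (nat \<Rightarrow> 'a \<Rightarrow> real) \<Rightarrow> nat \<Rightarrow> real \<Rightarrow> real \<Rightarrow> real" where
  "free_energy P \<omega> s \<beta> h =
     (THE F. AE x in P. (\<lambda>n. 1 / real s ^ n * ln (partition_fun P \<omega> s \<beta> h n 1 x)) \<longlonglongrightarrow> F)"

definition critical_point ::
  "'a measure \<Rightarrow> (nat \<Rightarrow> 'a \<Rightarrow> real) \<Rightarrow> nat \<Rightarrow> real \<Rightarrow> real" where
  "critical_point P \<omega> s \<beta> = Inf {h. free_energy P \<omega> s \<beta> h > 0}"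

end

theory Submission
  imports Defs
begin

text \<open>
  Write \<open>r = E R\<^sub>n\<close>, which obeys \<open>r' = (r\<^sup>s + s - 1) / s\<close>, and
  \<open>D\<^sub>n(p) = E (R\<^sub>n / r)\<^sup>p - 1\<close> for \<open>1 < p \<le> 2\<close>. Convexity of \<open>y\<^sup>p - 1 - p (y - 1)\<close> gives
  \<open>D' \<le> \<theta>\<^sup>p ((1 + D)\<^sup>s - 1)\<close> with \<open>\<theta> = r\<^sup>s / (r\<^sup>s + s - 1)\<close>; since \<open>\<theta> = 1/s\<close> at \<open>r = 1\<close>, a small
  \<open>D\<close> is contracted as long as \<open>r\<close> is close to \<open>1\<close>. So if \<open>h > 0\<close> and \<open>D\<^sub>n\<close> is small for some \<open>n\<close>,
  it stays small until \<open>r\<close> is large; then \<open>R\<^sub>n\<close> is large with high probability and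
  \<open>E ln R\<^sub>n > ln s\<close>, which forces a positive free energy because \<open>(E ln R\<^sub>n - ln s) / s\<^sup>n\<close> increases.

  The smallness of \<open>D\<^sub>n(p)\<close> for one \<open>p\<close> and one \<open>n\<close> is obtained at \<open>h = 0\<close>, for arbitrarily strong
  disorder, and carries over to small \<open>h\<close> by \<open>R\<^sub>n(h) \<le> exp(h s\<^sup>n) R\<^sub>n(0)\<close>. At \<open>h = 0\<close> the entropy
  \<open>H\<^sub>n = E R\<^sub>n ln R\<^sub>n\<close> is nonincreasing, because the product multiplies it by \<open>s\<close> and mixing with
  \<open>1\<close> divides it by at least \<open>s\<close>. The second logarithmic moment grows at most linearly in \<open>n\<close>, so
  as long as \<open>H\<^sub>n\<close> is bounded below the strict convexity of \<open>x ln x\<close> makes it drop by at least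
  \<open>const / n\<close>; the divergence of the harmonic series gives \<open>H\<^sub>n \<rightarrow> 0\<close>. As
  \<open>D\<^sub>n(1 + g) \<approx> g H\<^sub>n\<close> for small \<open>g\<close>, this suffices to enter the contraction regime.

  For \<open>h \<le> 0\<close> one has \<open>E R\<^sub>n \<le> 1\<close>, so the free energy vanishes. The almost sure limit exists because
  \<open>S \<mapsto> ln ((exp S + s - 1) / s)\<close> is \<open>1\<close>-Lipschitz, so that the variance of \<open>ln R\<^sub>n\<close> is \<open>O(s\<^sup>n)\<close>.
\<close>

section \<open>The scalar recursions\<close>

text \<open>Weighted AM-GM for \<open>w\<close> and \<open>1\<close> with weights \<open>g\<close>
  and \<open>1 - g\<close>.\<close>

lemma powr_le_Bernoulli:
  fixes w g :: real
  assumes "0 \<le> g" "g \<le> 1" "0 < w"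
  shows "w powr g \<le> 1 + g * (w - 1)"
  using Youngs_inequality_0[of g "1 - g" w 1] assms by (simp add: algebra_simps)

text \<open>With \<open>u = y - 1\<close>, the quotient of
  \<open>(1 + t * u) powr p - 1 - p * (t * u)\<close> by \<open>t powr p\<close> is nondecreasing on
  (0, 1]; compare \<open>t = \<theta>\<close> with \<open>t = 1\<close>. The sign of the derivative
  is Bernoulli's inequality with exponent \<open>p - 1\<close>, hence \<open>p \<le> 2\<close>.
  Convexity alone would give only the factor \<open>\<theta>\<close>; the exponent \<open>p\<close>
  is what beats the factor \<open>s\<close> coming from the product.\<close>

lemma powr_deviation_scale:
  fixes p \<theta> y :: real
  assumes p: "1 < p" "p \<le> 2" and \<theta>: "0 < \<theta>" "\<theta> \<le> 1" and y: "0 < y"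
  shows "(1 + \<theta> * (y - 1)) powr p - 1 - p * (\<theta> * (y - 1))
    \<le> \<theta> powr p * (y powr p - 1 - p * (y - 1))"
proof -
  define u where "u = y - 1"
  define q where "q t = ((1 + t * u) powr p - 1 - p * (t * u)) * t powr (-p)" for t
  have pos: "0 < 1 + t * u" if "0 < t" "t \<le> 1" for t
  proof -
    have "0 < (1 - t) + t * y"
      using that y by (smt (verit) mult_pos_pos)
    then show ?thesis by (simp add: u_def algebra_simps)
  qed
  have "q \<theta> \<le> q 1"
  proof (rule DERIV_nonneg_imp_nondecreasing[OF \<theta>(2)])
    fix t assume "\<theta> \<le> t" "t \<le> 1"
    then have t: "0 < t" "t \<le> 1" using \<theta> by auto
    define w where "w = 1 + t * u"
    have w: "0 < w" using pos[OF t] by (simp add: w_def)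
    let ?D = "(p * w powr (p - 1) * u - p * u) * t powr (-p)
              + (w powr p - 1 - p * (t * u)) * (- p * t powr (-p - 1))"
    have "(q has_real_derivative ?D) (at t)"
      unfolding q_def w_def using w t(1)
      by (auto intro!: derivative_eq_intros simp: w_def algebra_simps)
    moreover have "?D = p * t powr (-p - 1) * (1 + (p - 1) * (w - 1) - w powr (p - 1))"
    proof -
      have 1: "t powr (-p) = t powr (-p - 1) * t"
        using t powr_mult_base[of t "-p - 1"] by (simp add: mult.commute)
      have 2: "w powr p = w powr (p - 1) * w"
        using w powr_mult_base[of w "p - 1"] by (simp add: mult.commute)
      have 3: "t * u = w - 1" by (simp add: w_def)
      have "?D = p * t powr (-p - 1) *
          (w powr (p - 1) * (t * u) - t * u - w powr (p - 1) * w + 1 + p * (t * u))"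
        unfolding 1 2 by (simp add: algebra_simps)
      then show ?thesis unfolding 3 by (simp add: algebra_simps)
    qed
    moreover have "\<dots> \<ge> 0"
      using powr_le_Bernoulli[of "p - 1" w] p w by (intro mult_nonneg_nonneg) auto
    ultimately show "\<exists>y. (q has_real_derivative y) (at t) \<and> 0 \<le> y" by metis
  qed
  then have "q \<theta> * \<theta> powr p \<le> q 1 * \<theta> powr p"
    by (intro mult_right_mono) auto
  moreover have "\<theta> powr (-p) * \<theta> powr p = 1"
    using \<theta> by (simp add: powr_add[symmetric])
  ultimately show ?thesis
    unfolding q_def u_def by (simp add: mult.assoc) (simp add: mult.commute)
qed

lemma power_diff_one_le:
  fixes d :: real
  assumes "0 \<le> d" "0 < s"
  shows "(1 + d) ^ s - 1 \<le> s * d * (1 + d) ^ (s - 1)"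
proof -
  have "(1 + d) ^ s - 1 = d * (\<Sum>i<s. (1 + d) ^ i)"
    using power_diff_1_eq[of "1 + d" s] by simp
  also have "\<dots> \<le> d * (\<Sum>i<s. (1 + d) ^ (s - 1))"
    using assms by (intro mult_left_mono sum_mono power_increasing) auto
  finally show ?thesis by (simp add: algebra_simps)
qed

text \<open>Split off two factors and apply Bernoulli to the remaining \<open>s - 2\<close>. The
  quadratic term is what moves the mean away from its fixed point \<open>1\<close>.\<close>

lemma power_ge_quadratic:
  fixes u :: real
  assumes "0 \<le> u" "2 \<le> (s::nat)"
  shows "1 + s * u + u\<^sup>2 \<le> (1 + u) ^ s"
proof -
  obtain k where k: "s = k + 2" using assms(2) by (metis add.commute le_Suc_ex)
  have "1 + s * u + u\<^sup>2 \<le> (1 + k * u) * (1 + u)\<^sup>2"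
    using assms by (simp add: k algebra_simps power2_eq_square)
  also have "\<dots> \<le> (1 + u) ^ k * (1 + u)\<^sup>2"
    using Bernoulli_inequality[of u k] assms by (intro mult_right_mono) auto
  also have "\<dots> = (1 + u) ^ s" by (simp only: k power_add)
  finally show ?thesis .
qed

section \<open>Recursions for the mean and for the relative deviation\<close>

lemma ratio_mono:
  fixes a b c :: real
  assumes "0 < a" "a \<le> b" "0 \<le> c"
  shows "a / (a + c) \<le> b / (b + c)"
  using assms mult_right_mono[of a b c] by (simp add: divide_simps algebra_simps)

text \<open>An excess \<open>u\<close> over \<open>1\<close> grows by at least
  \<open>u\<^sup>2 / s\<close> per step and never drops below its initial value. The resulting
  linear bound is crude, but shows that \<open>r\<close> is unbounded once
  \<open>1 < r 0\<close>.\<close>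

lemma mean_growth:
  fixes r :: "nat \<Rightarrow> real"
  assumes s: "2 \<le> s" and r0: "1 \<le> r 0" and r: "\<And>m. r (Suc m) = (r m ^ s + real s - 1) / real s"
  shows "r 0 + m * (r 0 - 1)\<^sup>2 / s \<le> r m"
proof (induction m)
  case (Suc m)
  define u where "u = r m - 1"
  have "r 0 \<le> r m" using Suc.IH s by (smt (verit) divide_nonneg_nonneg mult_nonneg_nonneg of_nat_0_le_iff zero_le_power2)
  then have u: "r 0 - 1 \<le> u" "0 \<le> u" using r0 by (auto simp: u_def)
  then have "(r 0 - 1)\<^sup>2 \<le> u\<^sup>2" using r0 by (intro power_mono) auto
  moreover have "r (Suc m) \<ge> r m + u\<^sup>2 / s"
  proof -
    have "1 + s * u + u\<^sup>2 + real s - 1 \<le> r m ^ s + real s - 1"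
      using power_ge_quadratic[OF u(2) s] by (simp add: u_def)
    then have "(1 + s * u + u\<^sup>2 + real s - 1) / s \<le> r (Suc m)"
      unfolding r using s by (intro divide_right_mono) auto
    then show ?thesis using s by (simp add: u_def field_simps)
  qed
  ultimately have "r (Suc m) \<ge> r m + (r 0 - 1)\<^sup>2 / s"
    using s by (smt (verit) divide_right_mono of_nat_0_le_iff)
  then show ?case using Suc.IH by (simp add: add_divide_distrib distrib_right)
qed simp

text \<open>The point is that \<open>\<epsilon>\<close> does not depend on \<open>r 0\<close>,
  however close to \<open>1\<close> it is. In a first phase, of uncontrolled length,
  \<open>r \<le> 1 + x\<close> and \<open>D\<close> does not grow; from there a number of steps
  fixed in advance takes \<open>r\<close> past \<open>K\<close>, during which \<open>D\<close> grows
  by a controlled amount.\<close>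

lemma deviation_stays_small:
  fixes p \<delta> K :: real
  assumes s: "2 \<le> (s::nat)" and p: "1 < p" and \<delta>: "0 < \<delta>"
  shows "\<exists>\<epsilon>>0. \<forall>r D. 1 < r 0 \<longrightarrow> D 0 \<le> \<epsilon> \<longrightarrow> (\<forall>m. 0 \<le> D m) \<longrightarrow>
    (\<forall>m. r (Suc m) = (r m ^ s + real s - 1) / real s) \<longrightarrow>
    (\<forall>m. D (Suc m) \<le> (r m ^ s / (r m ^ s + real s - 1)) powr p * ((1 + D m) ^ s - 1)) \<longrightarrow>
    (\<exists>N>0. K < r N \<and> D N < \<delta>)"
proof -
  \<comment> \<open>\<open>f x\<close> bounds \<open>D (Suc m) / D m\<close> as long as
    \<open>r m \<le> 1 + x\<close> and \<open>D m \<le> x\<close>; at \<open>x = 0\<close> it equals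
    \<open>s powr (1 - p)\<close>, which is below \<open>1\<close>.\<close>
  define f where "f x = ((1+x)^s / ((1+x)^s + real s - 1)) powr p * (s * (1+x)^(s-1))" for x :: real
  have "f 0 < 1"
  proof -
    have "f 0 = real s powr (1 - p)"
      using s by (simp add: f_def powr_divide powr_diff powr_minus field_simps)
    also have "\<dots> < 1" using s p by (simp add: powr_less_one)
    finally show ?thesis .
  qed
  moreover have "isCont f 0"
    unfolding f_def using s by (intro continuous_intros) auto
  ultimately have "eventually (\<lambda>x. f x < 1) (at 0)"
    by (simp add: isCont_def order_tendstoD)
  then have "eventually (\<lambda>x. f x < 1) (at_right 0)"
    by (simp add: eventually_at_split)
  then have "eventually (\<lambda>x. 0 < x \<and> f x < 1) (at_right 0)"
    by (intro eventually_conj) (simp_all add: eventually_at_right_less)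
  then obtain x where x: "0 < x" "f x < 1"
    using eventually_happens'[OF trivial_limit_at_right_real] by blast
  obtain k where "(K - 1) / (x\<^sup>2 / s) < real k" using reals_Archimedean2 by blast
  then have k0: "K < 1 + real k * (x\<^sup>2 / s)"
    using x s by (subst (asm) pos_divide_less_eq) auto
  \<comment> \<open>One extra step guarantees \<open>N > 0\<close>; the logarithmic estimates start
    at generation 1 only.\<close>
  define k' where "k' = Suc k"
  have k: "K < 1 + real k' * (x\<^sup>2 / s)"
  proof -
    have "real k * (x\<^sup>2 / s) \<le> real k' * (x\<^sup>2 / s)"
      by (intro mult_right_mono) (auto simp: k'_def)
    then show ?thesis using k0 by linarith
  qed
  \<comment> \<open>\<open>k'\<close> steps raise \<open>1 + D\<close> at most to the power
    \<open>s ^ k'\<close>, so \<open>\<epsilon>\<close> must keep that power below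
    \<open>1 + \<delta>\<close>.\<close>
  have "isCont (\<lambda>e::real. (1 + e) ^ (s ^ k')) 0" by (intro continuous_intros)
  then have "((\<lambda>e::real. (1 + e) ^ (s ^ k')) \<longlongrightarrow> 1) (at 0)" by (simp add: isCont_def)
  then have "eventually (\<lambda>e::real. (1 + e) ^ (s ^ k') < 1 + \<delta>) (at_right 0)"
    using \<delta> by (intro order_tendstoD(2)[of _ 1]) (auto simp: filterlim_at_split)
  then have "eventually (\<lambda>e::real. 0 < e \<and> e < x \<and> (1 + e) ^ (s ^ k') < 1 + \<delta>) (at_right 0)"
    using x by (auto simp: eventually_conj_iff eventually_at_right_less intro: eventually_at_rightI[of _ x])
  then obtain \<epsilon> :: real where \<epsilon>: "0 < \<epsilon>" "\<epsilon> < x" "(1 + \<epsilon>) ^ (s ^ k') < 1 + \<delta>"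
    using eventually_happens'[OF trivial_limit_at_right_real] by blast
  have "\<exists>N>0. K < r N \<and> D N < \<delta>"
    if r0: "1 < r 0" and D0: "D 0 \<le> \<epsilon>" and Dn: "\<And>m. 0 \<le> D m"
      and r: "\<And>m. r (Suc m) = (r m ^ s + real s - 1) / real s"
      and D: "\<And>m. D (Suc m) \<le> (r m ^ s / (r m ^ s + real s - 1)) powr p * ((1 + D m) ^ s - 1)"
    for r D :: "nat \<Rightarrow> real"
  proof -
    have r1: "1 < r m" for m
      using mean_growth[OF s, of r m] r r0
      by (smt (verit) divide_nonneg_nonneg mult_nonneg_nonneg of_nat_0_le_iff zero_le_power2)
    define N0 where "N0 = (LEAST N. 1 + x < r N)"
    have "\<exists>N. 1 + x < r N"
    proof -
      obtain N where "x / ((r 0 - 1)\<^sup>2 / s) < real N" using reals_Archimedean2 by blast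
      then have "x < real N * ((r 0 - 1)\<^sup>2 / s)"
        using r0 s by (subst (asm) pos_divide_less_eq) auto
      then have "1 + x < r N" using mean_growth[OF s, of r N] r r0 by simp
      then show ?thesis ..
    qed
    then have N0: "1 + x < r N0" "\<And>m. m < N0 \<Longrightarrow> r m \<le> 1 + x"
      unfolding N0_def by (auto intro: LeastI_ex dest: not_less_Least)
    \<comment> \<open>First phase: the coefficient is monotone in \<open>r m \<le> 1 + x\<close>, so
      each step multiplies \<open>D\<close> by at most \<open>f x < 1\<close>.\<close>
    have small: "D m \<le> \<epsilon>" if "m \<le> N0" for m
      using that
    proof (induction m)
      case (Suc m)
      let ?t = "r m ^ s / (r m ^ s + real s - 1)" and ?u = "(1+x) ^ s / ((1+x)^s + real s - 1)"
      have IH: "D m \<le> \<epsilon>" and rm: "r m \<le> 1 + x" using Suc N0 by auto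
      have "r m ^ s \<le> (1+x)^s" using rm r1[of m] by (intro power_mono) auto
      then have t: "?t \<le> ?u"
        using ratio_mono[of "r m ^ s" "(1+x)^s" "real s - 1"] r1[of m] s by (simp add: add_diff_eq)
      have "0 < r m ^ s" using r1[of m] by (intro zero_less_power) auto
      then have t0: "0 \<le> ?t" using s by (intro divide_nonneg_nonneg) auto
      have "D (Suc m) \<le> ?t powr p * ((1 + D m) ^ s - 1)" by (rule D)
      also have "\<dots> \<le> ?u powr p * (s * D m * (1 + D m) ^ (s - 1))"
        using t t0 p s Dn power_diff_one_le[of "D m" s]
        by (intro mult_mono powr_mono2) (auto simp: one_le_power)
      also have "\<dots> \<le> ?u powr p * (s * D m * (1 + x) ^ (s - 1))"
        using Dn[of m] IH \<epsilon> by (intro mult_left_mono power_mono) auto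
      also have "\<dots> = D m * f x" by (simp add: f_def)
      also have "\<dots> \<le> D m * 1" using x Dn[of m] by (intro mult_left_mono) auto
      finally show ?case using IH by simp
    qed (rule D0)
    \<comment> \<open>Second phase: the coefficient is bounded by \<open>1\<close> only.\<close>
    have up: "1 + D (N0 + j) \<le> (1 + \<epsilon>) ^ (s ^ j)" for j
    proof (induction j)
      case 0
      then show ?case using small[of N0] by simp
    next
      case (Suc j)
      let ?m = "N0 + j"
      let ?t = "r ?m ^ s / (r ?m ^ s + real s - 1)"
      have pos: "1 < r ?m ^ s" using r1[of ?m] s by (intro one_less_power) auto
      have "?t \<le> 1" "0 \<le> ?t" using pos s by (auto simp: divide_simps)
      then have "?t powr p \<le> 1 powr p" using p by (intro powr_mono2) auto
      then have "?t powr p * ((1 + D ?m) ^ s - 1) \<le> 1 * ((1 + D ?m) ^ s - 1)"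
        using Dn[of ?m] by (intro mult_right_mono) (auto simp: one_le_power)
      then have "1 + D (Suc ?m) \<le> (1 + D ?m) ^ s" using D[of ?m] by simp
      also have "\<dots> \<le> ((1 + \<epsilon>) ^ (s ^ j)) ^ s"
        using Suc Dn[of ?m] by (intro power_mono) auto
      finally show ?case by (simp add: power_mult[symmetric] mult.commute)
    qed
    have "r (N0 + 0) + k' * (r (N0 + 0) - 1)\<^sup>2 / s \<le> r (N0 + k')"
      by (rule mean_growth[OF s, of "\<lambda>m. r (N0 + m)"]) (use r1[of N0] r in auto)
    moreover have "real k' * (x\<^sup>2 / s) \<le> k' * ((r N0 - 1)\<^sup>2 / s)"
      using N0 x by (intro mult_left_mono divide_right_mono power_mono) auto
    ultimately have "K < r (N0 + k')" using k N0 x by simp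
    moreover have "D (N0 + k') < \<delta>" using up[of k'] \<epsilon> by simp
    ultimately show ?thesis by (intro exI[of _ "N0 + k'"]) (auto simp: k'_def)
  qed
  then show ?thesis using \<epsilon>(1) by blast
qed

text \<open>This is the recursion at mean \<open>1\<close>. The linear factor is
  \<open>s powr (- g)\<close>, and the threshold on \<open>D n\<close> is such that
  \<open>(1 + D) ^ (s - 1)\<close> costs at most \<open>s powr (g / 2)\<close>, leaving the
  contraction rate \<open>\<rho> = s powr (- g / 2)\<close>. The threshold is of order
  \<open>g\<close>, which is exactly the order in which entropy controls the deviation.\<close>

lemma deviation_vanishes:
  fixes g \<epsilon> :: real
  assumes s: "2 \<le> (s::nat)" and g: "0 < g" and Dn: "\<And>m. 0 \<le> D m"
    and D: "\<And>m. D (Suc m) \<le> (1 / s) powr (1 + g) * ((1 + D m) ^ s - 1)"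
    and D0: "D n \<le> g * ln s / (2 * s)" and \<epsilon>: "0 < \<epsilon>"
  shows "\<exists>m\<ge>n. D m < \<epsilon>"
proof -
  define \<rho> where "\<rho> = exp (- g * ln s / 2)"
  have \<rho>: "0 < \<rho>" "\<rho> < 1" using g s by (auto simp: \<rho>_def)
  have step: "D (Suc m) \<le> \<rho> * D m" if "D m \<le> g * ln s / (2 * s)" for m
  proof -
    have "(1 + D m) ^ (s - 1) \<le> exp (D m) ^ (s - 1)"
      using Dn[of m] by (intro power_mono) auto
    also have "\<dots> = exp ((s - 1) * D m)" by (simp add: exp_of_nat_mult)
    also have "\<dots> \<le> exp (g * ln s / 2)"
    proof -
      have "(s - 1) * D m \<le> s * (g * ln s / (2 * s))"
        using that Dn[of m] s by (intro mult_mono) auto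
      then show ?thesis using s by simp
    qed
    finally have 1: "(1 + D m) ^ (s - 1) \<le> exp (g * ln s / 2)" .
    have "(1 / s) powr (1 + g) * s = exp (- g * ln s)"
      using s by (simp add: powr_def ln_div exp_minus exp_add[symmetric] algebra_simps)
        (simp add: exp_diff exp_minus exp_add field_simps)
    note 2 = this
    have "D (Suc m) \<le> (1 / s) powr (1 + g) * (s * D m * (1 + D m) ^ (s - 1))"
      using power_diff_one_le[of "D m" s] Dn[of m] s
      by (intro order_trans[OF D[of m]] mult_left_mono) auto
    also have "\<dots> \<le> (1 / s) powr (1 + g) * (s * D m * exp (g * ln s / 2))"
      using 1 Dn[of m] by (intro mult_left_mono) auto
    also have "\<dots> = ((1 / s) powr (1 + g) * s) * exp (g * ln s / 2) * D m" by simp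
    also have "\<dots> = \<rho> * D m" unfolding 2 \<rho>_def exp_add[symmetric] by simp
    finally show ?thesis .
  qed
  have *: "D (n + j) \<le> \<rho> ^ j * D n" for j
  proof (induction j)
    case (Suc j)
    have "\<rho> ^ j * D n \<le> 1 * D n"
      using \<rho> Dn[of n] by (intro mult_right_mono) (auto simp: power_le_one)
    then have "D (n + j) \<le> g * ln s / (2 * s)" using Suc D0 by simp
    from step[OF this] have "D (n + Suc j) \<le> \<rho> * D (n + j)" by simp
    also have "\<dots> \<le> \<rho> * (\<rho> ^ j * D n)" using Suc \<rho> by (intro mult_left_mono) auto
    finally show ?case by (simp add: mult.assoc)
  qed simp
  have "(\<lambda>j. \<rho> ^ j * D n) \<longlonglongrightarrow> 0 * D n"
    using \<rho> by (intro tendsto_intros LIMSEQ_power_zero) auto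
  then have "eventually (\<lambda>j. \<rho> ^ j * D n < \<epsilon>) sequentially"
    using \<epsilon> by (intro order_tendstoD) auto
  then obtain j where "\<rho> ^ j * D n < \<epsilon>" by (auto dest: eventually_happens)
  then show ?thesis using *[of j] by (intro exI[of _ "n + j"]) auto
qed

section \<open>Scalar inequalities for the entropy\<close>

text \<open>Since \<open>s * y = x + s - 1\<close>, one has \<open>x * ln x - s * (y * ln y) = - x *
  ln (y / x) - (s - 1) * ln y\<close>. Bounding both logarithms by \<open>ln z \<le> z - 1\<close>
  leaves linear terms that cancel. The second claim keeps a quadratic remainder in the first
  logarithm.\<close>

lemma entropy_step_le:
  fixes x :: real
  assumes s: "2 \<le> (s::nat)" and x: "0 < x"
  defines "y \<equiv> (x + real s - 1) / s"
  shows "y * ln y \<le> x * ln x / s"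
    and "1 \<le> x \<Longrightarrow> x / s * ((1 - y / x)\<^sup>2 / 4) \<le> x * ln x / s - y * ln y"
proof -
  have y: "0 < y" using s x by (simp add: y_def)
  have sy: "s * y = x + (real s - 1)" using s by (simp add: y_def)
  have "(real s - 1) * ln y \<le> (real s - 1) * (y - 1)"
    using s y ln_le_minus_one[of y] by (intro mult_left_mono) auto
  then have main: "(x * ln x - s * (y * ln y)) \<ge> x * (- ln (y / x)) + (real s - 1) * (1 - y)"
    using x y arg_cong[OF sy, of "\<lambda>z. z * ln y"] by (simp add: ln_div algebra_simps)
  have id: "x * (1 - y / x) + (real s - 1) * (1 - y) = 0"
    using sy x by (simp add: algebra_simps)
  have "x * (1 - y / x) \<le> x * (- ln (y / x))"
    using ln_le_minus_one[of "y / x"] x y by (intro mult_left_mono) auto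
  then have "0 \<le> x * ln x - s * (y * ln y)" using main id by simp
  then show "y * ln y \<le> x * ln x / s" using s by (simp add: field_simps)
  show "x / s * ((1 - y / x)\<^sup>2 / 4) \<le> x * ln x / s - y * ln y" if x1: "1 \<le> x"
  proof -
    \<comment> \<open>Applying \<open>ln z \<le> z - 1\<close> to the square root instead of
      \<open>y / x\<close> produces the extra term \<open>(1 - q)\<^sup>2\<close>.\<close>
    define q where "q = sqrt (y / x)"
    have q: "0 < q" "q\<^sup>2 = y / x" using x y by (auto simp: q_def)
    have "s * y \<le> s * x" unfolding sy using x1 s mult_left_mono[of 1 x "real s - 1"]
      by (simp add: algebra_simps)
    then have "y \<le> x" using s by simp
    then have q1: "q \<le> 1" using x by (simp add: q_def)
    have "ln (y / x) = 2 * ln q" using q(1) by (simp add: q(2)[symmetric] ln_realpow)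
    also have "\<dots> \<le> 2 * (q - 1)" using ln_le_minus_one[OF q(1)] by simp
    finally have "- ln (y / x) \<ge> (1 - q\<^sup>2) + (1 - q)\<^sup>2"
      by (simp add: power2_eq_square algebra_simps)
    moreover have "(1 - q)\<^sup>2 \<ge> ((1 - q\<^sup>2) / 2)\<^sup>2"
    proof -
      have "(1 - q\<^sup>2) / 2 \<le> 1 - q" "0 \<le> (1 - q\<^sup>2) / 2"
        using q1 q(1) zero_le_power2[of "1 - q"] power_le_one[of q 2] by (auto simp: power2_diff)
      then show ?thesis by (intro power_mono)
    qed
    ultimately have "x * (- ln (y / x)) \<ge> x * ((1 - y / x) + (1 - y / x)\<^sup>2 / 4)"
      using x by (intro mult_left_mono) (auto simp: q(2) power_divide)
    then have "x * ((1 - y / x)\<^sup>2 / 4) \<le> x * ln x - s * (y * ln y)"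
      using main id by (simp add: distrib_left)
    then have "x * ((1 - y / x)\<^sup>2 / 4) / s \<le> (x * ln x - s * (y * ln y)) / s"
      using s by (intro divide_right_mono) auto
    then show ?thesis using s by (simp add: diff_divide_distrib)
  qed
qed

text \<open>The relative distance \<open>1 - y / x = (1 - 1/s) * (1 - 1/x)\<close> increases with
  \<open>x\<close>, so the quadratic remainder is uniformly positive away from
  \<open>1\<close>.\<close>

lemma entropy_gap:
  fixes K :: real
  assumes s: "2 \<le> (s::nat)" and K: "1 < K"
  shows "\<exists>c>0. \<forall>x\<ge>K. c * x \<le> x * ln x / s - (x + real s - 1) / s * ln ((x + real s - 1) / s)"
proof -
  define q where "q x = (x + real s - 1) / s / x" for x :: real
  have q: "1 - q x = (1 - 1 / s) * (1 - 1 / x)" if "0 < x" for x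
    using that s by (simp add: q_def field_simps)
  define c where "c = (1 - q K)\<^sup>2 / (4 * s)"
  have "1 - q K > 0" unfolding q[of K, OF less_trans[OF zero_less_one K]]
    using s K by (intro mult_pos_pos) auto
  then have "0 < c" using s unfolding c_def by (intro divide_pos_pos) auto
  moreover have "c * x \<le> x * ln x / s - (x + real s - 1) / s * ln ((x + real s - 1) / s)" if "K \<le> x" for x
  proof -
    have x: "1 \<le> x" "0 < x" using that K by auto
    have "1 - q K \<le> 1 - q x"
      unfolding q[OF x(2)] q[of K, OF less_trans[OF zero_less_one K]]
      using that K s by (intro mult_left_mono) (auto simp: field_simps)
    then have "(1 - q K)\<^sup>2 \<le> (1 - q x)\<^sup>2" using \<open>1 - q K > 0\<close> by (intro power_mono) auto
    then have "x / s * ((1 - q K)\<^sup>2 / 4) \<le> x / s * ((1 - q x)\<^sup>2 / 4)"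
      using x by (intro mult_left_mono divide_right_mono) auto
    also have "\<dots> \<le> x * ln x / s - (x + real s - 1) / s * ln ((x + real s - 1) / s)"
      using entropy_step_le(2)[OF s x(2) x(1)] by (simp add: q_def)
    finally show ?thesis by (simp add: c_def algebra_simps)
  qed
  ultimately show ?thesis by blast
qed

lemma abs_ln_le_powr:
  fixes x a :: real
  assumes "0 < x" "0 < a"
  shows "\<bar>ln x\<bar> \<le> (1 / a) * max (x powr a) (x powr (-a))"
proof -
  have *: "ln z \<le> (1 / a) * z powr a" if "0 < z" for z
    using ln_le_minus_one[of "z powr a"] that assms(2) by (simp add: ln_powr field_simps)
  have "ln x \<le> (1 / a) * x powr a" "- ln x \<le> (1 / a) * x powr (-a)"
    using *[of x] *[of "1 / x"] assms by (auto simp: ln_div powr_divide powr_minus inverse_eq_divide)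
  then show ?thesis using assms(2)
    by (smt (verit) mult_left_mono max.cobounded1 max.cobounded2 divide_nonneg_nonneg)
qed

text \<open>Second-order Taylor expansion of \<open>exp (g * ln x)\<close>. The remainder is
  dominated by \<open>1 + x\<^sup>2\<close> uniformly in \<open>g \<le> 1/4\<close>, so that after
  taking expectations the deviation of order \<open>1 + g\<close> is governed by the
  entropy.\<close>

lemma powr_expansion:
  fixes x g :: real
  assumes x: "0 < x" and g: "0 < g" "g \<le> 1 / 4"
  shows "x powr (1 + g) \<le> x + g * (x * ln x) + g\<^sup>2 * (8 * (1 + x\<^sup>2))"
proof -
  define l where "l = g * ln x"
  obtain t where t: "\<bar>t\<bar> \<le> \<bar>l\<bar>" "exp l = (\<Sum>m<2. l ^ m / fact m) + exp t / fact 2 * l ^ 2"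
    using Maclaurin_exp_le[of l 2] by blast
  have "exp t \<le> exp \<bar>l\<bar>" using t by simp
  then have e: "exp l \<le> 1 + l + exp \<bar>l\<bar> / 2 * l\<^sup>2"
    using t(2) mult_right_mono[of "exp t" "exp \<bar>l\<bar>" "l\<^sup>2"] by (simp add: numeral_2_eq_2)
  \<comment> \<open>\<open>m\<close> equals \<open>exp (\<bar>ln x\<bar> / 4)\<close>. One copy
    bounds the exponential and two bound the square of the logarithm, up to constants;
    \<open>x * m ^ 3\<close> then has exponent 7/4 or 1/4, within the range of
    \<open>1 + x\<^sup>2\<close>.\<close>
  define m where "m = max (x powr (1/4)) (x powr (-(1/4)))"
  have m0: "0 < m" using x by (simp add: m_def less_max_iff_disj)
  have l1: "\<bar>ln x\<bar> \<le> 4 * m" using abs_ln_le_powr[OF x, of "1/4"] by (simp add: m_def)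
  have "exp \<bar>l\<bar> \<le> exp (\<bar>ln x\<bar> / 4)"
    using g mult_right_mono[of g "1/4" "\<bar>ln x\<bar>"] by (simp add: l_def abs_mult)
  also have "\<dots> = m"
    using x by (auto simp: m_def powr_def abs_if max_def)
  finally have em: "exp \<bar>l\<bar> \<le> m" .
  have "\<bar>ln x\<bar>\<^sup>2 \<le> (4 * m)\<^sup>2" using l1 by (intro power_mono) auto
  then have "l\<^sup>2 \<le> g\<^sup>2 * (4 * m)\<^sup>2"
    unfolding l_def power_mult_distrib[of g] by (intro mult_left_mono) auto
  then have "exp \<bar>l\<bar> / 2 * l\<^sup>2 \<le> m / 2 * (g\<^sup>2 * (4 * m)\<^sup>2)"
    using em m0 by (intro mult_mono divide_right_mono) auto
  also have "\<dots> = g\<^sup>2 * (8 * m ^ 3)" by (simp add: power2_eq_square power3_eq_cube)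
  finally have "exp l \<le> 1 + l + g\<^sup>2 * (8 * m ^ 3)" using e by simp
  then have "x * exp l \<le> x * (1 + l + g\<^sup>2 * (8 * m ^ 3))" using x by (intro mult_left_mono) auto
  moreover have "x * m ^ 3 \<le> 1 + x\<^sup>2"
  proof (cases "1 \<le> x")
    case True
    then have "m = x powr (1/4)" unfolding m_def by (intro max_absorb1 powr_mono) auto
    then have "x * m ^ 3 = x powr (1 + 3/4)"
      using x by (simp only: powr_add) (simp add: powr_power)
    also have "\<dots> \<le> x powr 2" using True by (intro powr_mono) auto
    finally show ?thesis using x by (simp add: powr_numeral)
  next
    case False
    then have "m = x powr (-(1/4))" using x unfolding m_def by (intro max_absorb2 powr_mono') auto
    then have "x * m ^ 3 = x powr (1 + - (3/4))"
      using x by (simp only: powr_add) (simp add: powr_power)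
    also have "\<dots> \<le> 1 powr (1 + - (3/4))" using False x by (intro powr_mono2) auto
    finally show ?thesis by (simp add: add_increasing2)
  qed
  then have "g\<^sup>2 * (8 * (x * m ^ 3)) \<le> g\<^sup>2 * (8 * (1 + x\<^sup>2))" by (intro mult_left_mono) auto
  moreover have "x powr (1 + g) = x * exp l" using x by (simp add: powr_add powr_def[of x g] l_def)
  ultimately show ?thesis by (simp add: l_def algebra_simps)
qed

section \<open>The hierarchical recursion for i.i.d. initial data\<close>

context prob_space begin

lemma indep_vars_reindex:
  assumes "indep_vars M' X I" and t: "inj_on t L" "t ` L \<subseteq> I"
  shows "indep_vars (\<lambda>j. M' (t j)) (\<lambda>j. X (t j)) L"
proof -
  have "disjoint_family_on (\<lambda>j. {t j}) L"
    using t(1) by (auto simp: disjoint_family_on_def inj_on_def)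
  then have "indep_vars (\<lambda>j. PiM {t j} M') (\<lambda>j \<omega>. restrict (\<lambda>i. X i \<omega>) {t j}) L"
    using t(2) by (intro indep_vars_restrict[OF assms(1)]) auto
  from indep_vars_compose2[OF this, of "\<lambda>j f. f (t j)" "\<lambda>j. M' (t j)"]
  show ?thesis by (simp add: measurable_component_singleton)
qed

text \<open>For independent variables the joint law is the product of the marginals, so equal
  marginals give equal joint laws, and hence equal laws of any function of them.\<close>

lemma distr_function_of_indep_family:
  assumes "indep_vars (\<lambda>_. N) X L" "indep_vars (\<lambda>_. N) Y L" "L \<noteq> {}"
    and "\<And>j. j \<in> L \<Longrightarrow> distr M N (X j) = distr M N (Y j)"
    and f: "f \<in> measurable (PiM L (\<lambda>_. N)) K"
  shows "distr M K (\<lambda>x. f (\<lambda>j\<in>L. X j x)) = distr M K (\<lambda>x. f (\<lambda>j\<in>L. Y j x))"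
proof -
  have rv: "random_variable N (X j)" "random_variable N (Y j)" if "j \<in> L" for j
    using assms(1,2) that by (auto simp: indep_vars_def)
  have *: "distr M (PiM L (\<lambda>_. N)) (\<lambda>x. \<lambda>j\<in>L. X j x) = distr M (PiM L (\<lambda>_. N)) (\<lambda>x. \<lambda>j\<in>L. Y j x)"
    using indep_vars_iff_distr_eq_PiM'[OF assms(3), where M' = "\<lambda>_. N" and X = X] assms(1)
      indep_vars_iff_distr_eq_PiM'[OF assms(3), where M' = "\<lambda>_. N" and X = Y] assms(2) rv assms(4)
    by (auto intro!: PiM_cong)
  have m: "(\<lambda>x. \<lambda>j\<in>L. X j x) \<in> measurable M (PiM L (\<lambda>_. N))"
     "(\<lambda>x. \<lambda>j\<in>L. Y j x) \<in> measurable M (PiM L (\<lambda>_. N))"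
    using rv by (auto intro!: measurable_restrict)
  show ?thesis
    using arg_cong[OF *, of "\<lambda>\<mu>. distr \<mu> K f"] distr_distr[OF f m(1)] distr_distr[OF f m(2)]
    by (simp add: comp_def)
qed

text \<open>The series of squares has finite expectation by monotone convergence, so it converges
  almost surely and its terms vanish.\<close>

lemma AE_tendsto_of_summable_square:
  fixes Y :: "nat \<Rightarrow> 'a \<Rightarrow> real"
  assumes int: "\<And>n. integrable M (\<lambda>x. (Y n x)\<^sup>2)" and [measurable]: "\<And>n. Y n \<in> borel_measurable M"
    and sm: "summable (\<lambda>n. expectation (\<lambda>x. (Y n x)\<^sup>2))"
  shows "AE x in M. (\<lambda>n. Y n x) \<longlonglongrightarrow> 0"
proof -
  have "(\<integral>\<^sup>+x. (\<Sum>n. ennreal ((Y n x)\<^sup>2)) \<partial>M) = (\<Sum>n. \<integral>\<^sup>+x. ennreal ((Y n x)\<^sup>2) \<partial>M)"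
    by (intro nn_integral_suminf) auto
  also have "\<dots> = (\<Sum>n. ennreal (expectation (\<lambda>x. (Y n x)\<^sup>2)))"
    by (intro suminf_cong nn_integral_eq_integral int) auto
  also have "\<dots> = ennreal (\<Sum>n. expectation (\<lambda>x. (Y n x)\<^sup>2))"
    using sm by (intro suminf_ennreal2) auto
  finally have "(\<integral>\<^sup>+x. (\<Sum>n. ennreal ((Y n x)\<^sup>2)) \<partial>M) \<noteq> \<infinity>" by simp
  then have "AE x in M. (\<Sum>n. ennreal ((Y n x)\<^sup>2)) \<noteq> \<infinity>"
    by (intro nn_integral_PInf_AE) auto
  then show ?thesis
  proof eventually_elim
    case (elim x)
    then have "summable (\<lambda>n. (Y n x)\<^sup>2)" by (intro summable_suminf_not_top) auto
    then have "(\<lambda>n. (Y n x)\<^sup>2) \<longlonglongrightarrow> 0" by (rule summable_LIMSEQ_zero)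
    then have "(\<lambda>n. sqrt ((Y n x)\<^sup>2)) \<longlonglongrightarrow> sqrt 0" by (intro tendsto_intros)
    then show ?case by (simp add: tendsto_rabs_zero_iff)
  qed
qed

end

text \<open>Only the law of the i.i.d. starting values enters the analysis. Keeping \<open>R\<close>
  a parameter allows the recursions at several values of \<open>h\<close> to be instances on one
  probability space.\<close>

locale hierarchical_iid = prob_space M for M :: "'a measure" +
  fixes s :: nat and R :: "nat \<Rightarrow> nat \<Rightarrow> 'a \<Rightarrow> real"
  assumes s: "2 \<le> s"
    and indep0: "indep_vars (\<lambda>_. borel) (R 0) UNIV"
    and distr0: "distr M borel (R 0 i) = distr M borel (R 0 0)"
    and pos0: "0 < R 0 i x"
    and square_integrable0: "integrable M (\<lambda>x. (R 0 0 x)\<^sup>2)"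
    and R_Suc: "R (Suc n) i x = ((\<Prod>j=1..s. R n (s * i + j) x) + real s - 1) / real s"
begin

lemma pos [simp]: "0 < R n i x"
proof (induction n arbitrary: i)
  case (Suc n)
  then have "0 < (\<Prod>j=1..s. R n (s * i + j) x)" by (intro prod_pos) auto
  then show ?case using s by (simp add: R_Suc)
qed (rule pos0)

lemma nonneg [simp]: "0 \<le> R n i x"
  using pos[of n i x] by linarith

lemma nonzero [simp]: "R n i x \<noteq> 0"
  using pos[of n i x] by linarith

lemma disjoint_blocks: "disjoint_family_on (\<lambda>i. (\<lambda>j. s * i + j) ` {1..s}) UNIV"
proof -
  have "i = i'" if "s * i + j = s * i' + j'" "j \<in> {1..s}" "j' \<in> {1..s}" for i i' j j'
  proof -
    \<comment> \<open>The offsets run from 1 to \<open>s\<close>, so \<open>j - 1\<close> is the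
      true remainder and the quotient recovers the block.\<close>
    have "(s * i + (j - 1)) div s = (s * i' + (j' - 1)) div s"
      using that by (metis Nat.add_diff_assoc atLeastAtMost_iff)
    moreover have "j - 1 < s" "j' - 1 < s" using that by auto
    ultimately show ?thesis using s by simp
  qed
  then show ?thesis unfolding disjoint_family_on_def by blast
qed

text \<open>Variables of the next generation are functions of disjoint blocks of the current
  one.\<close>

lemma indep: "indep_vars (\<lambda>_. borel) (R n) UNIV"
proof (induction n)
  case (Suc n)
  let ?K = "\<lambda>i. (\<lambda>j. s * i + j) ` {1..s}"
  let ?f = "\<lambda>i v. ((\<Prod>j=1..s. v (s * i + j)) + real s - 1) / real s"
  have "indep_vars (\<lambda>i. PiM (?K i) (\<lambda>_. borel)) (\<lambda>i x. restrict (\<lambda>k. R n k x) (?K i)) UNIV"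
    by (intro indep_vars_restrict[OF Suc] disjoint_blocks) auto
  then have "indep_vars (\<lambda>_. borel) (\<lambda>i x. ?f i (restrict (\<lambda>k. R n k x) (?K i))) UNIV"
  proof (rule indep_vars_compose2[where Y = ?f])
    show "?f i \<in> borel_measurable (PiM (?K i) (\<lambda>_. borel :: real measure))" for i
    by (intro borel_measurable_divide borel_measurable_diff borel_measurable_add
        borel_measurable_const borel_measurable_prod measurable_component_singleton) auto
  qed
  moreover have "?f i (restrict (\<lambda>k. R n k x) (?K i)) = R (Suc n) i x" for i x
    unfolding R_Suc by simp
  ultimately show ?case by simp
qed (rule indep0)

lemma measurable_R [measurable]: "R n i \<in> borel_measurable M"
  using indep[of n] by (auto simp: indep_vars_def)

lemma indep_block: "indep_vars (\<lambda>_. borel) (\<lambda>j. R n (s * i + j)) {1..s}"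
  by (rule indep_vars_reindex[OF indep]) (auto simp: inj_on_def)

lemma distr_R: "distr M borel (R n i) = distr M borel (R n 0)"
proof (induction n arbitrary: i)
  case (Suc n)
  let ?f = "\<lambda>v. ((\<Prod>j=1..s. v j) + real s - 1) / real s"
  have "distr M borel (\<lambda>x. ?f (\<lambda>j\<in>{1..s}. R n (s * i + j) x))
      = distr M borel (\<lambda>x. ?f (\<lambda>j\<in>{1..s}. R n (s * 0 + j) x))"
  proof (rule distr_function_of_indep_family[OF indep_block indep_block])
    show "?f \<in> borel_measurable (PiM {1..s} (\<lambda>_. borel))"
      by (intro borel_measurable_divide borel_measurable_diff borel_measurable_add
        borel_measurable_const borel_measurable_prod measurable_component_singleton) auto
    show "distr M borel (R n (s * i + j)) = distr M borel (R n (s * 0 + j))" for j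
      unfolding Suc[of "s * i + j"] Suc[of "s * 0 + j"] ..
  qed (use s in auto)
  then show ?case by (simp add: R_Suc[abs_def])
qed (rule distr0)

lemma
  fixes f :: "real \<Rightarrow> real"
  assumes [measurable]: "f \<in> borel_measurable borel"
  shows integrable_R_iff: "integrable M (\<lambda>x. f (R n i x)) \<longleftrightarrow> integrable M (\<lambda>x. f (R n 0 x))"
    and expectation_R: "expectation (\<lambda>x. f (R n i x)) = expectation (\<lambda>x. f (R n 0 x))"
proof -
  have "integrable M (\<lambda>x. f (R n k x)) \<longleftrightarrow> integrable (distr M borel (R n k)) f" for k
    by (simp add: integrable_distr_eq)
  then show "integrable M (\<lambda>x. f (R n i x)) \<longleftrightarrow> integrable M (\<lambda>x. f (R n 0 x))"
    using distr_R by metis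
  have "expectation (\<lambda>x. f (R n k x)) = integral\<^sup>L (distr M borel (R n k)) f" for k
    by (simp add: integral_distr)
  then show "expectation (\<lambda>x. f (R n i x)) = expectation (\<lambda>x. f (R n 0 x))"
    using distr_R by metis
qed

text \<open>The factors may depend on \<open>j\<close>, so that one or two sites of a block can
  later be singled out.\<close>

lemma
  fixes f :: "nat \<Rightarrow> real \<Rightarrow> real"
  assumes f [measurable]: "\<And>j. f j \<in> borel_measurable borel"
    and int: "\<And>j. j \<in> {1..s} \<Longrightarrow> integrable M (\<lambda>x. f j (R n 0 x))"
  shows integrable_block_prod: "integrable M (\<lambda>x. \<Prod>j=1..s. f j (R n (s * i + j) x))"
    and expectation_block_prod: "expectation (\<lambda>x. \<Prod>j=1..s. f j (R n (s * i + j) x))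
      = (\<Prod>j=1..s. expectation (\<lambda>x. f j (R n 0 x)))"
proof -
  have ind: "indep_vars (\<lambda>_. borel) (\<lambda>j x. f j (R n (s * i + j) x)) {1..s}"
    by (rule indep_vars_compose2[OF indep_block]) auto
  have int': "integrable M (\<lambda>x. f j (R n (s * i + j) x))" if "j \<in> {1..s}" for j
    using int[OF that] by (subst integrable_R_iff) auto
  show "integrable M (\<lambda>x. \<Prod>j=1..s. f j (R n (s * i + j) x))"
    by (rule indep_vars_integrable[OF _ ind]) (use int' in auto)
  have "expectation (\<lambda>x. \<Prod>j=1..s. f j (R n (s * i + j) x))
      = (\<Prod>j=1..s. expectation (\<lambda>x. f j (R n (s * i + j) x)))"
    by (rule indep_vars_lebesgue_integral[OF _ ind]) (use int' in auto)
  also have "\<dots> = (\<Prod>j=1..s. expectation (\<lambda>x. f j (R n 0 x)))"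
    by (intro prod.cong refl expectation_R f)
  finally show "expectation (\<lambda>x. \<Prod>j=1..s. f j (R n (s * i + j) x))
      = (\<Prod>j=1..s. expectation (\<lambda>x. f j (R n 0 x)))" .
qed

text \<open>The block feeding \<open>R (Suc n) 0\<close>; since all sites of a generation have the
  same law, site 0 can represent them.\<close>

abbreviation X :: "nat \<Rightarrow> 'a \<Rightarrow> real" where
  "X n x \<equiv> (\<Prod>j=1..s. R n j x)"

lemma R_Suc_0: "R (Suc n) 0 x = (X n x + real s - 1) / real s"
  by (simp add: R_Suc)

lemma X_pos: "0 < X n x"
  by (intro prod_pos) auto

lemma square_integrable: "integrable M (\<lambda>x. (R n 0 x)\<^sup>2)"
proof (induction n)
  case (Suc n)
  have "integrable M (\<lambda>x. \<Prod>j=1..s. (R n (s * 0 + j) x)\<^sup>2)"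
    using Suc by (intro integrable_block_prod[where f = "\<lambda>_ y. y\<^sup>2"]) auto
  then have int: "integrable M (\<lambda>x. (X n x)\<^sup>2)" by (simp add: prod_power_distrib)
  show ?case
  proof (rule Bochner_Integration.integrable_bound)
    show "integrable M (\<lambda>x. 2 * (X n x)\<^sup>2 + 2 * (real s)\<^sup>2)" using int by simp
    have "(R (Suc n) 0 x)\<^sup>2 \<le> 2 * (X n x)\<^sup>2 + 2 * (real s)\<^sup>2" for x
    proof -
      have "R (Suc n) 0 x \<le> X n x + s"
      proof -
        have "R (Suc n) 0 x \<le> X n x + real s - 1"
          unfolding R_Suc_0 using s X_pos[of n x]
            divide_left_mono[of 1 "real s" "X n x + real s - 1"] by simp
        then show ?thesis by simp
      qed
      then have "(R (Suc n) 0 x)\<^sup>2 \<le> (X n x + s)\<^sup>2" by (intro power_mono) auto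
      also have "\<dots> \<le> 2 * (X n x)\<^sup>2 + 2 * (real s)\<^sup>2"
        using zero_le_power2[of "X n x - s"] by (simp add: power2_eq_square algebra_simps)
      finally show ?thesis .
    qed
    then show "AE x in M. norm ((R (Suc n) 0 x)\<^sup>2) \<le> norm (2 * (X n x)\<^sup>2 + 2 * (real s)\<^sup>2)"
      by (auto simp: abs_of_nonneg)
  qed auto
qed (rule square_integrable0)

text \<open>Second moments persist through all generations, so at most quadratic growth settles the
  integrability of the powers, logarithms and entropies used below.\<close>

lemma integrable_dominated:
  fixes f :: "real \<Rightarrow> real"
  assumes [measurable]: "f \<in> borel_measurable borel"
    and b: "\<And>y. 0 < y \<Longrightarrow> \<bar>f y\<bar> \<le> C * (1 + y\<^sup>2)"
  shows "integrable M (\<lambda>x. f (R n i x))"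
proof -
  have "integrable M (\<lambda>x. f (R n 0 x))"
  proof (rule Bochner_Integration.integrable_bound)
    show "integrable M (\<lambda>x. C * (1 + (R n 0 x)\<^sup>2))" using square_integrable by simp
    show "AE x in M. norm (f (R n 0 x)) \<le> norm (C * (1 + (R n 0 x)\<^sup>2))"
    proof (intro AE_I2)
      fix x
      show "norm (f (R n 0 x)) \<le> norm (C * (1 + (R n 0 x)\<^sup>2))"
        using b[OF pos, of n 0 x] by (metis abs_ge_self order_trans real_norm_def)
    qed
    show "(\<lambda>x. f (R n 0 x)) \<in> borel_measurable M" by measurable
  qed
  then show ?thesis by (subst integrable_R_iff) auto
qed

lemma integrable_R [simp]: "integrable M (\<lambda>x. R n i x)"
proof (rule integrable_dominated[of "\<lambda>y. y" 1])
  show "\<bar>y\<bar> \<le> 1 * (1 + y\<^sup>2)" for y :: real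
    using zero_le_power2[of "\<bar>y\<bar> - 1"] by (simp add: power2_eq_square algebra_simps)
qed auto

definition mean :: "nat \<Rightarrow> real" where
  "mean n = expectation (\<lambda>x. R n 0 x)"

lemma
  shows integrable_X [simp]: "integrable M (\<lambda>x. X n x)"
    and expectation_X: "expectation (\<lambda>x. X n x) = mean n ^ s"
proof -
  show "integrable M (\<lambda>x. X n x)"
    using integrable_block_prod[where f = "\<lambda>_ y. y" and n = n and i = 0] by simp
  show "expectation (\<lambda>x. X n x) = mean n ^ s"
    using expectation_block_prod[where f = "\<lambda>_ y. y" and n = n and i = 0] by (simp add: mean_def)
qed

lemma mean_Suc: "mean (Suc n) = (mean n ^ s + real s - 1) / real s"
proof -
  have "mean (Suc n) = expectation (\<lambda>x. (X n x + (real s - 1)) / real s)"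
    unfolding mean_def R_Suc_0 by (simp add: add_diff_eq)
  also have "\<dots> = (mean n ^ s + (real s - 1)) / real s"
    using Bochner_Integration.integral_add[OF integrable_X, of "\<lambda>_. real s - 1" n]
    by (simp only: integral_divide_zero expectation_X) (simp add: prob_space)
  finally show ?thesis by simp
qed

lemma mean_pos: "0 < mean n"
  unfolding mean_def using integral_less_AE_space[of "\<lambda>_. 0" "\<lambda>x. R n 0 x"] by (simp add: emeasure_space_1)

end

section \<open>Moment deviations\<close>

lemma powr_le_one_plus_square:
  fixes p y :: real
  assumes "0 \<le> p" "p \<le> 2" "0 < y"
  shows "y powr p \<le> 1 + y\<^sup>2"
proof (cases "1 \<le> y")
  case True
  then have "y powr p \<le> y powr 2" using assms by (intro powr_mono) auto
  then show ?thesis using assms by simp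
next
  case False
  then have "y powr p \<le> 1 powr p" using assms by (intro powr_mono2) auto
  then show ?thesis by (simp add: add_increasing2)
qed

text \<open>Bernoulli with exponent \<open>1 / p\<close> at the point
  \<open>y powr p\<close>.\<close>

lemma powr_deviation_nonneg:
  fixes p y :: real
  assumes "1 < p" "0 < y"
  shows "0 \<le> y powr p - 1 - p * (y - 1)"
  using powr_le_Bernoulli[of "1 / p" "y powr p"] assms by (simp add: powr_powr field_simps)

text \<open>The quantity is the deviation \<open>y powr p - 1 - p * (y - 1)\<close> at
  \<open>y = 1/2\<close>. It is positive because \<open>ln 2 < 1\<close>.\<close>

lemma powr_deviation_half_pos:
  fixes p :: real
  assumes "1 < p"
  shows "0 < (1/2) powr p - 1 + p / 2"
proof -
  have "(p - 1) * ln 2 < (p - 1) * 1"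
    using assms ln2_le_25_over_36 by (intro mult_strict_left_mono) auto
  then have "1 - (p - 1) < 1 + - ((p - 1) * ln 2)" by simp
  also have "\<dots> \<le> exp (- ((p - 1) * ln 2))" by (rule exp_ge_add_one_self)
  also have "\<dots> = (1/2) powr (p - 1)" by (simp add: powr_def ln_div)
  also have "\<dots> = 2 * (1/2) powr p" by (simp add: powr_diff)
  finally show ?thesis by simp
qed

text \<open>Apply the scaling inequality with the \<open>\<theta>\<close> that moves
  \<open>y\<close> to \<open>1/2\<close>. This makes a small \<open>D\<close> incompatible with
  frequently falling below half the mean.\<close>

lemma powr_deviation_half_le:
  fixes p y :: real
  assumes p: "1 < p" "p \<le> 2" and y: "0 < y" "y \<le> 1 / 2"
  shows "(1/2) powr p - 1 + p / 2 \<le> y powr p - 1 - p * (y - 1)"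
proof -
  define \<theta> where "\<theta> = 1 / (2 * (1 - y))"
  have \<theta>: "0 < \<theta>" "\<theta> \<le> 1" "\<theta> * (y - 1) = - 1 / 2"
    using y by (auto simp: \<theta>_def field_simps)
  have "(1/2) powr p - 1 + p / 2 \<le> \<theta> powr p * (y powr p - 1 - p * (y - 1))"
    using powr_deviation_scale[OF p \<theta>(1,2) y(1)] unfolding \<theta>(3) by simp
  also have "\<dots> \<le> 1 * (y powr p - 1 - p * (y - 1))"
    using powr_deviation_nonneg[OF p(1) y(1)] \<theta> p powr_mono2[of p \<theta> 1]
    by (intro mult_right_mono) auto
  finally show ?thesis by simp
qed

text \<open>The Lipschitz property in the variable \<open>ln x\<close>: as
  \<open>x / (x + s - 1)\<close> is monotone, adding \<open>s - 1\<close> to both numbers brings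
  their ratio closer to \<open>1\<close>.\<close>

lemma abs_ln_step_le:
  fixes x y :: real
  assumes s: "2 \<le> (s::nat)" and "0 < x" "0 < y"
  shows "\<bar>ln ((x + real s - 1) / s) - ln ((y + real s - 1) / s)\<bar> \<le> \<bar>ln x - ln y\<bar>"
proof -
  have *: "\<bar>ln ((x + real s - 1) / s) - ln ((y + real s - 1) / s)\<bar> \<le> \<bar>ln x - ln y\<bar>"
    if xy: "0 < x" "x \<le> y" for x y :: real
  proof -
    have a: "0 < x + (real s - 1)" "0 < y + (real s - 1)" using s xy by auto
    have "x / (x + (real s - 1)) \<le> y / (y + (real s - 1))"
      using xy s by (intro ratio_mono) auto
    then have "(y + (real s - 1)) / (x + (real s - 1)) \<le> y / x"
      using xy a by (simp add: divide_simps mult.commute split: if_splits)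
    then have "ln ((y + (real s - 1)) / (x + (real s - 1))) \<le> ln (y / x)"
      using a xy by (subst ln_le_cancel_iff) auto
    then have "ln (y + (real s - 1)) - ln (x + (real s - 1)) \<le> ln y - ln x"
      using a xy by (simp add: ln_div)
    moreover have "ln (x + (real s - 1)) \<le> ln (y + (real s - 1))" "ln x \<le> ln y"
      using a xy by auto
    ultimately show ?thesis using a s by (simp add: ln_div add_diff_eq[symmetric])
  qed
  show ?thesis
    using *[of x y] *[of y x] assms by (cases "x \<le> y") (auto simp: abs_minus_commute)
qed

context hierarchical_iid
begin

text \<open>The weight \<open>w = 1\<close> gives the variance of \<open>ln R\<close>, the weight \<open>w y = y\<close> the size-biased moments of \<open>ln R\<close>.\<close>

lemma
  assumes w [measurable]: "w \<in> borel_measurable borel" and iw: "integrable M (\<lambda>x. w (R n 0 x))"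
    and Ew: "expectation (\<lambda>x. w (R n 0 x)) = (1::real)"
    and f [measurable]: "f \<in> borel_measurable borel" and ifw: "integrable M (\<lambda>x. w (R n 0 x) * f (R n 0 x))"
    and j: "j \<in> {1..s}"
  shows integrable_weighted: "integrable M (\<lambda>x. (\<Prod>i=1..s. w (R n i x)) * f (R n j x))"
    and expectation_weighted: "expectation (\<lambda>x. (\<Prod>i=1..s. w (R n i x)) * f (R n j x))
      = expectation (\<lambda>x. w (R n 0 x) * f (R n 0 x))"
proof -
  let ?f = "\<lambda>i y. w y * (if i = j then f y else 1)"
  have 1: "(\<Prod>i=1..s. ?f i (R n (s * 0 + i) x)) = (\<Prod>i=1..s. w (R n i x)) * f (R n j x)" for x
    using j by (simp add: prod.distrib prod.delta)
  have meas: "?f i \<in> borel_measurable borel" for i by auto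
  have int: "integrable M (\<lambda>x. ?f i (R n 0 x))" for i using iw ifw by (cases "i = j") auto
  show "integrable M (\<lambda>x. (\<Prod>i=1..s. w (R n i x)) * f (R n j x))"
    using integrable_block_prod[of ?f, OF meas int, where i = 0] unfolding 1 .
  have "expectation (\<lambda>x. (\<Prod>i=1..s. w (R n i x)) * f (R n j x))
      = (\<Prod>i=1..s. expectation (\<lambda>x. ?f i (R n 0 x)))"
    using expectation_block_prod[of ?f, OF meas int, where i = 0] unfolding 1 .
  also have "\<dots> = (\<Prod>i=1..s. if i = j then expectation (\<lambda>x. w (R n 0 x) * f (R n 0 x)) else 1)"
    by (intro prod.cong) (auto simp: Ew)
  also have "\<dots> = expectation (\<lambda>x. w (R n 0 x) * f (R n 0 x))"
    using j by (simp add: prod.delta)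
  finally show "expectation (\<lambda>x. (\<Prod>i=1..s. w (R n i x)) * f (R n j x))
      = expectation (\<lambda>x. w (R n 0 x) * f (R n 0 x))" .
qed

text \<open>A weight of mean \<open>1\<close> acts as a change of measure under which the sites stay
  independent; a mixed term is therefore the square of the tilted mean.\<close>

lemma
  assumes w [measurable]: "w \<in> borel_measurable borel" and iw: "integrable M (\<lambda>x. w (R n 0 x))"
    and Ew: "expectation (\<lambda>x. w (R n 0 x)) = (1::real)"
    and f [measurable]: "f \<in> borel_measurable borel" and ifw: "integrable M (\<lambda>x. w (R n 0 x) * f (R n 0 x))"
    and j: "j \<in> {1..s}" and k: "k \<in> {1..s}" and jk: "j \<noteq> k"
  shows integrable_weighted_pair:
      "integrable M (\<lambda>x. (\<Prod>i=1..s. w (R n i x)) * (f (R n j x) * f (R n k x)))"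
    and expectation_weighted_pair:
      "expectation (\<lambda>x. (\<Prod>i=1..s. w (R n i x)) * (f (R n j x) * f (R n k x)))
      = (expectation (\<lambda>x. w (R n 0 x) * f (R n 0 x)))\<^sup>2"
proof -
  let ?f = "\<lambda>i y. w y * ((if i = j then f y else 1) * (if i = k then f y else 1))"
  let ?e = "expectation (\<lambda>x. w (R n 0 x) * f (R n 0 x))"
  have 1: "(\<Prod>i=1..s. ?f i (R n (s * 0 + i) x)) = (\<Prod>i=1..s. w (R n i x)) * (f (R n j x) * f (R n k x))" for x
    using j k by (simp only: prod.distrib) (simp add: prod.delta)
  have meas: "?f i \<in> borel_measurable borel" for i by measurable
  have int: "integrable M (\<lambda>x. ?f i (R n 0 x))" for i
    using iw ifw jk by (cases "i = j"; cases "i = k") auto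
  show "integrable M (\<lambda>x. (\<Prod>i=1..s. w (R n i x)) * (f (R n j x) * f (R n k x)))"
    using integrable_block_prod[of ?f, OF meas int, where i = 0] unfolding 1 .
  have "expectation (\<lambda>x. (\<Prod>i=1..s. w (R n i x)) * (f (R n j x) * f (R n k x)))
      = (\<Prod>i=1..s. expectation (\<lambda>x. ?f i (R n 0 x)))"
    using expectation_block_prod[of ?f, OF meas int, where i = 0] unfolding 1 .
  also have "\<dots> = (\<Prod>i=1..s. (if i = j then ?e else 1) * (if i = k then ?e else 1))"
    using jk by (intro prod.cong) (auto simp: Ew)
  also have "\<dots> = ?e\<^sup>2"
    using j k by (simp only: prod.distrib) (simp add: prod.delta power2_eq_square)
  finally show "expectation (\<lambda>x. (\<Prod>i=1..s. w (R n i x)) * (f (R n j x) * f (R n k x))) = ?e\<^sup>2" .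
qed

lemma
  assumes w [measurable]: "w \<in> borel_measurable borel" and iw: "integrable M (\<lambda>x. w (R n 0 x))"
    and Ew: "expectation (\<lambda>x. w (R n 0 x)) = (1::real)"
    and f [measurable]: "f \<in> borel_measurable borel" and ifw: "integrable M (\<lambda>x. w (R n 0 x) * f (R n 0 x))"
    and iffw: "integrable M (\<lambda>x. w (R n 0 x) * (f (R n 0 x))\<^sup>2)"
  shows integrable_weighted_square:
      "integrable M (\<lambda>x. (\<Prod>i=1..s. w (R n i x)) * (\<Sum>j=1..s. f (R n j x))\<^sup>2)"
    and expectation_weighted_square:
      "expectation (\<lambda>x. (\<Prod>i=1..s. w (R n i x)) * (\<Sum>j=1..s. f (R n j x))\<^sup>2)
      = s * expectation (\<lambda>x. w (R n 0 x) * (f (R n 0 x))\<^sup>2)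
        + s * (real s - 1) * (expectation (\<lambda>x. w (R n 0 x) * f (R n 0 x)))\<^sup>2"
proof -
  let ?W = "\<lambda>x. \<Prod>i=1..s. w (R n i x)"
  let ?A = "expectation (\<lambda>x. w (R n 0 x) * (f (R n 0 x))\<^sup>2)"
  let ?B = "(expectation (\<lambda>x. w (R n 0 x) * f (R n 0 x)))\<^sup>2"
  have f2: "(\<lambda>y. (f y)\<^sup>2) \<in> borel_measurable borel" by measurable
  have eq: "?W x * (\<Sum>j=1..s. f (R n j x))\<^sup>2
      = (\<Sum>j=1..s. \<Sum>k=1..s. ?W x * (f (R n j x) * f (R n k x)))" for x
    by (simp only: power2_eq_square sum_product) (simp only: sum_distrib_left)
  have int: "integrable M (\<lambda>x. ?W x * (f (R n j x) * f (R n k x)))"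
    and E: "expectation (\<lambda>x. ?W x * (f (R n j x) * f (R n k x))) = (if j = k then ?A else ?B)"
    if "j \<in> {1..s}" "k \<in> {1..s}" for j k
    using integrable_weighted[OF w iw Ew f2 iffw that(1)] expectation_weighted[OF w iw Ew f2 iffw that(1)]
      integrable_weighted_pair[OF w iw Ew f ifw that] expectation_weighted_pair[OF w iw Ew f ifw that]
    by (auto simp: power2_eq_square)
  show "integrable M (\<lambda>x. ?W x * (\<Sum>j=1..s. f (R n j x))\<^sup>2)"
    unfolding eq using int by (intro Bochner_Integration.integrable_sum) auto
  have "expectation (\<lambda>x. ?W x * (\<Sum>j=1..s. f (R n j x))\<^sup>2)
      = (\<Sum>j=1..s. \<Sum>k=1..s. expectation (\<lambda>x. ?W x * (f (R n j x) * f (R n k x))))"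
    unfolding eq using int
    by (subst Bochner_Integration.integral_sum, (intro Bochner_Integration.integrable_sum; simp),
        intro sum.cong refl Bochner_Integration.integral_sum) auto
  \<comment> \<open>Diagonal and off-diagonal values are rewritten as \<open>?B\<close> everywhere
    plus \<open>?A - ?B\<close> on the diagonal.\<close>
  also have "\<dots> = (\<Sum>j=1..s. \<Sum>k=1..s. (if k = j then ?A - ?B else 0) + ?B)"
    using E by (intro sum.cong) auto
  also have "\<dots> = (\<Sum>j=1..s. (?A - ?B) + s * ?B)"
    by (intro sum.cong refl) (simp add: sum.distrib sum.delta)
  also have "\<dots> = s * ?A + s * (real s - 1) * ?B" by (simp add: algebra_simps)
  finally show "expectation (\<lambda>x. ?W x * (\<Sum>j=1..s. f (R n j x))\<^sup>2) = s * ?A + s * (real s - 1) * ?B" .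
qed

definition dev :: "real \<Rightarrow> nat \<Rightarrow> real" where
  "dev p n = expectation (\<lambda>x. R n 0 x powr p) / mean n powr p - 1"

lemma integrable_powr:
  assumes "0 \<le> p" "p \<le> 2"
  shows "integrable M (\<lambda>x. R n i x powr p)"
  using powr_le_one_plus_square[OF assms] by (intro integrable_dominated[where C = 1]) auto

lemma
  assumes p: "0 \<le> p" "p \<le> 2"
  shows integrable_X_powr: "integrable M (\<lambda>x. X n x powr p)"
    and expectation_X_powr: "expectation (\<lambda>x. X n x powr p) = expectation (\<lambda>x. R n 0 x powr p) ^ s"
proof -
  have eq: "X n x powr p = (\<Prod>j=1..s. R n (s * 0 + j) x powr p)" for x
    by (simp add: prod_powr_distrib)
  show "integrable M (\<lambda>x. X n x powr p)"
    unfolding eq using integrable_powr[OF p] by (intro integrable_block_prod[where f = "\<lambda>_ y. y powr p"]) auto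
  show "expectation (\<lambda>x. X n x powr p) = expectation (\<lambda>x. R n 0 x powr p) ^ s"
    unfolding eq using integrable_powr[OF p] by (subst expectation_block_prod[where f = "\<lambda>_ y. y powr p"]) auto
qed

text \<open>The subtracted linear term has mean zero, so \<open>dev\<close> is the expectation of a
  pointwise nonnegative deviation.\<close>

lemma dev_bound:
  assumes p: "1 < p" "p \<le> 2"
  shows "expectation (\<lambda>x. (R n 0 x / mean n) powr p - 1 - p * (R n 0 x / mean n - 1)) = dev p n"
    and "integrable M (\<lambda>x. (R n 0 x / mean n) powr p - 1 - p * (R n 0 x / mean n - 1))"
proof -
  have eq: "(R n 0 x / mean n) powr p - 1 - p * (R n 0 x / mean n - 1)
      = R n 0 x powr p / mean n powr p - p / mean n * R n 0 x + (p - 1)" for x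
    using mean_pos[of n] by (simp add: powr_divide algebra_simps)
  have int: "integrable M (\<lambda>x. R n 0 x powr p)" using integrable_powr p by auto
  show "integrable M (\<lambda>x. (R n 0 x / mean n) powr p - 1 - p * (R n 0 x / mean n - 1))"
    unfolding eq using int by auto
  show "expectation (\<lambda>x. (R n 0 x / mean n) powr p - 1 - p * (R n 0 x / mean n - 1)) = dev p n"
    unfolding eq using int mean_pos[of n] by (simp add: prob_space dev_def mean_def)
qed

lemma dev_nonneg:
  assumes "1 < p" "p \<le> 2"
  shows "0 \<le> dev p n"
  unfolding dev_bound(1)[OF assms, symmetric]
  using powr_deviation_nonneg[OF assms(1)] mean_pos[of n] by (intro Bochner_Integration.integral_nonneg) auto

text \<open>After division by the means the step reads \<open>1 + \<theta> * (Y - 1)\<close>, where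
  \<open>Y\<close> is the normalised product. The scaling inequality yields
  \<open>\<theta> powr p\<close>, and independence gives \<open>1 + dev p n\<close> to the power
  \<open>s\<close> as the moment of \<open>Y\<close>.\<close>

lemma dev_Suc:
  assumes p: "1 < p" "p \<le> 2"
  shows "dev p (Suc n) \<le> (mean n ^ s / (mean n ^ s + real s - 1)) powr p * ((1 + dev p n) ^ s - 1)"
proof -
  let ?m = "mean n ^ s"
  define \<theta> where "\<theta> = ?m / (?m + real s - 1)"
  define Y where "Y x = X n x / ?m" for x
  have m: "0 < ?m" using mean_pos[of n] by simp
  have \<theta>: "0 < \<theta>" "\<theta> \<le> 1" using m s by (auto simp: \<theta>_def divide_simps)
  have Y: "0 < Y x" for x using X_pos m by (simp add: Y_def)
  have R: "R (Suc n) 0 x / mean (Suc n) = 1 + \<theta> * (Y x - 1)" for x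
  proof -
    have "0 < ?m + real s - 1" using m s by simp
    have *: "a / b * (z / a - 1) = (z - a) / b" if "0 < a" "0 < b" for a b z :: real
      using that by (simp add: field_simps)
    have "\<theta> * (Y x - 1) = (X n x - ?m) / (?m + real s - 1)"
      unfolding \<theta>_def Y_def by (rule *) fact+
    then have "1 + \<theta> * (Y x - 1) = (X n x + real s - 1) / (?m + real s - 1)"
      using \<open>0 < ?m + real s - 1\<close> by (simp add: field_simps)
    then show ?thesis using s by (simp add: R_Suc_0 mean_Suc)
  qed
  have intp: "integrable M (\<lambda>x. X n x powr p)" using integrable_X_powr p by auto
  have eq: "Y x powr p - 1 - p * (Y x - 1) = X n x powr p / ?m powr p - p / ?m * X n x + (p - 1)" for x
    using m X_pos[of n x] by (simp add: Y_def powr_divide algebra_simps)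
  have int: "integrable M (\<lambda>x. Y x powr p - 1 - p * (Y x - 1))"
    unfolding eq using intp integrable_X by auto
  have "expectation (\<lambda>x. Y x powr p - 1 - p * (Y x - 1)) = expectation (\<lambda>x. X n x powr p) / ?m powr p - 1"
    unfolding eq using intp integrable_X[of n] mean_pos[of n] expectation_X[of n] by (simp add: prob_space)
  also have "\<dots> = (1 + dev p n) ^ s - 1"
    using p mean_pos[of n] expectation_X_powr[of p n]
    by (simp add: dev_def power_divide powr_power mult.commute flip: powr_realpow powr_powr)
      (simp add: powr_powr mult.commute)
  finally have E: "expectation (\<lambda>x. Y x powr p - 1 - p * (Y x - 1)) = (1 + dev p n) ^ s - 1" .
  have "dev p (Suc n) \<le> expectation (\<lambda>x. \<theta> powr p * (Y x powr p - 1 - p * (Y x - 1)))"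
    unfolding dev_bound(1)[OF p, symmetric]
  proof (rule integral_mono[OF dev_bound(2)[OF p]])
    show "integrable M (\<lambda>x. \<theta> powr p * (Y x powr p - 1 - p * (Y x - 1)))" using int by simp
    show "(R (Suc n) 0 x / mean (Suc n)) powr p - 1 - p * (R (Suc n) 0 x / mean (Suc n) - 1)
        \<le> \<theta> powr p * (Y x powr p - 1 - p * (Y x - 1))" for x
      unfolding R using powr_deviation_scale[OF p \<theta> Y[of x]] by simp
  qed
  then show ?thesis by (simp add: E \<theta>_def)
qed

end

section \<open>The free energy\<close>

text \<open>\<open>ln (R 0 i)\<close> need not be integrable; from \<open>n = 1\<close> on \<open>R n i \<ge> 1/2\<close> and clipping changes nothing.\<close>

definition clip_ln :: "real \<Rightarrow> real" where
  "clip_ln y = ln (max y (1 / 2))"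

lemma measurable_clip_ln [measurable]: "clip_ln \<in> borel_measurable borel"
  unfolding clip_ln_def by measurable

lemma abs_clip_ln_le: "0 < y \<Longrightarrow> \<bar>clip_ln y\<bar> \<le> max 1 y"
proof -
  assume y: "0 < y"
  define z where "z = max y (1 / 2)"
  have z: "1 / 2 \<le> z" "0 < z" by (auto simp: z_def)
  have "- ln z = ln (1 / z)" using z by (simp add: ln_div)
  also have "\<dots> \<le> 1 / z - 1" using z by (intro ln_le_minus_one) auto
  also have "\<dots> \<le> 1" using z by (simp add: divide_simps)
  finally have "- ln z \<le> 1" .
  moreover have "ln z \<le> max 1 y" using ln_le_minus_one[of z] z by (auto simp: z_def)
  ultimately show ?thesis unfolding clip_ln_def z_def[symmetric] by linarith
qed

lemma clip_ln_square_le: "0 < y \<Longrightarrow> (clip_ln y)\<^sup>2 \<le> 1 * (1 + y\<^sup>2)"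
proof -
  assume y: "0 < y"
  have "\<bar>clip_ln y\<bar>\<^sup>2 \<le> (max 1 y)\<^sup>2" using abs_clip_ln_le[OF y] by (intro power_mono) auto
  then show ?thesis by (auto simp: max_def intro: order_trans split: if_splits)
qed

context hierarchical_iid
begin

lemma R_ge_half:
  assumes "1 \<le> n"
  shows "1 / 2 \<le> R n i x"
proof -
  obtain m where n: "n = Suc m" using assms by (cases n) auto
  have "0 < (\<Prod>j=1..s. R m (s * i + j) x)" by (intro prod_pos) auto
  then show ?thesis using s unfolding n R_Suc by (simp add: field_simps)
qed

lemma clip_ln_R: "1 \<le> n \<Longrightarrow> clip_ln (R n i x) = ln (R n i x)"
  using R_ge_half[of n i x] by (simp add: clip_ln_def max_absorb1)

lemma integrable_clip_ln_square: "integrable M (\<lambda>x. (clip_ln (R n i x))\<^sup>2)"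
  using clip_ln_square_le by (intro integrable_dominated[where C = 1]) auto

lemma integrable_clip_ln: "integrable M (\<lambda>x. clip_ln (R n i x))"
proof (rule integrable_dominated)
  show "\<bar>clip_ln y\<bar> \<le> 1 * (1 + y\<^sup>2)" if "0 < y" for y
    using abs_clip_ln_le[OF that] zero_le_power2[of "y - 1"] that
    by (auto simp: power2_eq_square algebra_simps max_def intro: order_trans split: if_splits)
qed auto

section \<open>Mean and variance of the logarithm\<close>

definition mean_ln :: "nat \<Rightarrow> real" where
  "mean_ln n = expectation (\<lambda>x. clip_ln (R n 0 x))"

definition var_ln :: "nat \<Rightarrow> real" where
  "var_ln n = expectation (\<lambda>x. (clip_ln (R n 0 x) - mean_ln n)\<^sup>2)"

lemma ln_X: "1 \<le> n \<Longrightarrow> ln (X n x) = (\<Sum>j=1..s. clip_ln (R n j x))"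
  by (subst ln_prod) (auto simp: clip_ln_R less_imp_neq[OF pos, symmetric])

lemma expectation_ln_X:
  assumes "1 \<le> n"
  shows "integrable M (\<lambda>x. ln (X n x))" "expectation (\<lambda>x. ln (X n x)) = s * mean_ln n"
proof -
  have E: "expectation (\<lambda>x. clip_ln (R n j x)) = mean_ln n" for j
    unfolding mean_ln_def by (rule expectation_R) auto
  show "integrable M (\<lambda>x. ln (X n x))" "expectation (\<lambda>x. ln (X n x)) = s * mean_ln n"
    unfolding ln_X[OF assms] using integrable_clip_ln
    by (auto intro!: Bochner_Integration.integrable_sum simp: Bochner_Integration.integral_sum E)
qed

text \<open>The mean square about any constant \<open>c\<close> is at least the variance, which
  leaves the centring in the next estimate free.\<close>

lemma
  shows integrable_square_diff: "integrable M (\<lambda>x. (clip_ln (R n i x) - c)\<^sup>2)"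
    and expectation_square_diff:
      "expectation (\<lambda>x. (clip_ln (R n 0 x) - c)\<^sup>2) = var_ln n + (mean_ln n - c)\<^sup>2"
proof -
  have eq: "(clip_ln (R n i x) - c)\<^sup>2 = (clip_ln (R n i x))\<^sup>2 - 2 * c * clip_ln (R n i x) + c\<^sup>2" for i x c
    by (simp add: power2_eq_square algebra_simps)
  show "integrable M (\<lambda>x. (clip_ln (R n i x) - c)\<^sup>2)"
    unfolding eq using integrable_clip_ln integrable_clip_ln_square by auto
  have E: "expectation (\<lambda>x. (clip_ln (R n 0 x) - c)\<^sup>2)
      = expectation (\<lambda>x. (clip_ln (R n 0 x))\<^sup>2) - 2 * c * mean_ln n + c\<^sup>2" for c
    unfolding eq mean_ln_def using integrable_clip_ln[of n 0] integrable_clip_ln_square[of n 0]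
    by (simp add: prob_space)
  show "expectation (\<lambda>x. (clip_ln (R n 0 x) - c)\<^sup>2) = var_ln n + (mean_ln n - c)\<^sup>2"
    unfolding var_ln_def E by (simp add: power2_eq_square algebra_simps)
qed

lemma var_ln_nonneg: "0 \<le> var_ln n"
  unfolding var_ln_def by simp

lemma var_ln_Suc:
  assumes n: "1 \<le> n"
  shows "var_ln (Suc n) \<le> s * var_ln n"
proof -
  \<comment> \<open>The centring \<open>c\<close> is the logarithm of the image under the step of
    \<open>m\<close>, where \<open>ln m\<close> is the mean of \<open>ln (X n x)\<close>. The
    Lipschitz property then compares with the variance of a sum of \<open>s\<close> independent
    terms.\<close>
  define m where "m = exp (s * mean_ln n)"
  define c where "c = ln ((m + real s - 1) / s)"
  let ?Z = "\<lambda>x. clip_ln (R n 0 x) - mean_ln n"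
  have one: "(\<lambda>_::real. 1::real) \<in> borel_measurable borel"
    and f: "(\<lambda>y. clip_ln y - mean_ln n) \<in> borel_measurable borel" by measurable
  have i1: "integrable M (\<lambda>x. 1 * (clip_ln (R n 0 x) - mean_ln n))"
    and i2: "integrable M (\<lambda>x. 1 * (clip_ln (R n 0 x) - mean_ln n)\<^sup>2)"
    using integrable_clip_ln[of n 0] integrable_square_diff[of n 0] by auto
  have sum: "(\<Prod>i=1..s. 1) * (\<Sum>j=1..s. clip_ln (R n j x) - mean_ln n)\<^sup>2 = (ln (X n x) - s * mean_ln n)\<^sup>2" for x
    unfolding ln_X[OF n] by (simp add: sum_subtractf)
  have int: "integrable M (\<lambda>x. (ln (X n x) - s * mean_ln n)\<^sup>2)"
    using integrable_weighted_square[OF one _ _ f i1 i2] by (simp only: sum) (simp add: prob_space)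
  have "expectation (\<lambda>x. (ln (X n x) - s * mean_ln n)\<^sup>2) = s * var_ln n"
    using expectation_weighted_square[OF one _ _ f i1 i2] integrable_clip_ln[of n 0]
    by (simp only: sum) (simp add: prob_space var_ln_def[symmetric] mean_ln_def[symmetric])
  note E = this
  have "var_ln (Suc n) \<le> expectation (\<lambda>x. (clip_ln (R (Suc n) 0 x) - c)\<^sup>2)"
    unfolding expectation_square_diff by simp
  also have "\<dots> \<le> expectation (\<lambda>x. (ln (X n x) - s * mean_ln n)\<^sup>2)"
  proof (rule integral_mono[OF integrable_square_diff int])
    fix x
    have "\<bar>clip_ln (R (Suc n) 0 x) - c\<bar> \<le> \<bar>ln (X n x) - ln m\<bar>"
      using abs_ln_step_le[OF s X_pos[of n x], of m]
      by (simp add: clip_ln_R c_def m_def) (simp add: R_Suc_0)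
    then show "(clip_ln (R (Suc n) 0 x) - c)\<^sup>2 \<le> (ln (X n x) - s * mean_ln n)\<^sup>2"
      by (simp add: m_def abs_le_square_iff)
  qed
  finally show ?thesis using E by simp
qed

lemma mean_ln_Suc_ge:
  assumes n: "1 \<le> n"
  shows "s * mean_ln n - ln s \<le> mean_ln (Suc n)"
proof -
  have "expectation (\<lambda>x. ln (X n x) - ln s) \<le> mean_ln (Suc n)"
    unfolding mean_ln_def
  proof (rule integral_mono[OF _ integrable_clip_ln])
    show "integrable M (\<lambda>x. ln (X n x) - ln s)" using expectation_ln_X[OF n] by auto
    fix x
    have "ln (X n x) - ln s = ln (X n x / s)" using X_pos[of n x] s by (simp add: ln_div)
    also have "\<dots> \<le> ln (R (Suc n) 0 x)"
      using X_pos[of n x] s unfolding R_Suc_0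
      by (subst ln_le_cancel_iff) (auto intro!: divide_right_mono divide_pos_pos)
    finally show "ln (X n x) - ln s \<le> clip_ln (R (Suc n) 0 x)" by (simp add: clip_ln_R)
  qed
  then show ?thesis using expectation_ln_X[OF n] by (simp add: prob_space)
qed

text \<open>Every factor is at least \<open>1/2\<close>, so \<open>X n x * 2 ^ s\<close> is at least
  \<open>1\<close> and absorbs the added \<open>s - 1\<close>.\<close>

lemma mean_ln_Suc_le:
  assumes n: "1 \<le> n"
  shows "mean_ln (Suc n) \<le> s * mean_ln n + s * ln 2"
proof -
  have "mean_ln (Suc n) \<le> expectation (\<lambda>x. ln (X n x) + s * ln 2)"
    unfolding mean_ln_def
  proof (rule integral_mono[OF integrable_clip_ln])
    show "integrable M (\<lambda>x. ln (X n x) + s * ln 2)" using expectation_ln_X[OF n] by auto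
    fix x
    have X2: "1 \<le> X n x * 2 ^ s"
    proof -
      have "(1 / 2) ^ s = (\<Prod>j=1..s. 1 / 2 :: real)" by simp
      also have "\<dots> \<le> X n x" using R_ge_half[OF n] by (intro prod_mono) auto
      finally show ?thesis by (simp add: field_simps power_one_over)
    qed
    have "R (Suc n) 0 x \<le> X n x * 2 ^ s"
    proof -
      have "(1::real) \<le> 2 ^ s" by simp
      then have "X n x * 1 \<le> X n x * 2 ^ s" using X_pos[of n x] by (intro mult_left_mono) auto
      moreover have "(real s - 1) * 1 \<le> (real s - 1) * (X n x * 2 ^ s)"
        using s X2 by (intro mult_left_mono) auto
      ultimately have "X n x + (real s - 1) \<le> s * (X n x * 2 ^ s)" by (simp add: algebra_simps)
      then show ?thesis using s unfolding R_Suc_0 by (simp add: divide_le_eq mult.commute)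
    qed
    then have "ln (R (Suc n) 0 x) \<le> ln (X n x * 2 ^ s)"
      using X_pos[of n x] by (subst ln_le_cancel_iff) auto
    also have "\<dots> = ln (X n x) + s * ln 2" using X_pos[of n x] by (simp add: ln_mult ln_realpow)
    finally show "clip_ln (R (Suc n) 0 x) \<le> ln (X n x) + s * ln 2" by (simp add: clip_ln_R)
  qed
  then show ?thesis using expectation_ln_X[OF n] by (simp add: prob_space)
qed

text \<open>Subtracting \<open>ln s\<close> makes the quotients increase, adding
  \<open>s * ln 2\<close> makes them decrease; \<open>s \<ge> 2\<close> absorbs the correction in
  both cases. The second conjunct turns a single generation with \<open>mean_ln n > ln s\<close>
  into a positive limit.\<close>

lemma mean_ln_limit:
  "\<exists>F. (\<lambda>n. mean_ln n / s ^ n) \<longlonglongrightarrow> F \<and> (\<forall>n\<ge>1. (mean_ln n - ln s) / s ^ n \<le> F)"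
proof -
  define u where "u n = (mean_ln (Suc n) - ln s) / s ^ Suc n" for n
  define v where "v n = (mean_ln (Suc n) + s * ln 2) / s ^ Suc n" for n
  have ln_s: "0 \<le> ln s" using s by simp
  have "incseq u"
  proof (rule incseq_SucI)
    fix n
    have "2 * ln s \<le> s * ln s" using s ln_s by (intro mult_right_mono) auto
    then have "s * (mean_ln (Suc n) - ln s) \<le> mean_ln (Suc (Suc n)) - ln s"
      using mean_ln_Suc_ge[of "Suc n"] by (simp add: algebra_simps)
    then have "s * (mean_ln (Suc n) - ln s) / s ^ Suc (Suc n) \<le> u (Suc n)"
      unfolding u_def by (intro divide_right_mono) auto
    then show "u n \<le> u (Suc n)" using s by (simp add: u_def)
  qed
  have "decseq v"
  proof (rule decseq_SucI)
    fix n
    have "2 * (s * ln 2) \<le> s * (s * ln (2::real))" using s by (intro mult_right_mono) auto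
    then have "mean_ln (Suc (Suc n)) + s * ln 2 \<le> s * (mean_ln (Suc n) + s * ln 2)"
      using mean_ln_Suc_le[of "Suc n"] by (simp add: algebra_simps)
    then have "v (Suc n) \<le> s * (mean_ln (Suc n) + s * ln 2) / s ^ Suc (Suc n)"
      unfolding v_def by (intro divide_right_mono) auto
    then show "v (Suc n) \<le> v n" using s by (simp add: v_def)
  qed
  have "u n \<le> v 0" for n
  proof -
    have "- ln s \<le> s * ln (2::real)" using ln_s by (smt (verit) mult_nonneg_nonneg of_nat_0_le_iff ln_gt_zero)
    then have "u n \<le> v n" unfolding u_def v_def by (intro divide_right_mono) auto
    also have "\<dots> \<le> v 0" using \<open>decseq v\<close> by (simp add: decseq_def)
    finally show ?thesis .
  qed
  then obtain F where F: "u \<longlonglongrightarrow> F" "\<And>n. u n \<le> F"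
    using incseq_convergent[OF \<open>incseq u\<close>, of "v 0"] by blast
  have "(\<lambda>n. ln s * (1 / s) ^ Suc n) \<longlonglongrightarrow> ln s * 0"
    using s by (intro tendsto_mult_left LIMSEQ_Suc LIMSEQ_power_zero) auto
  from tendsto_add[OF F(1) this] have "(\<lambda>n. mean_ln (Suc n) / s ^ Suc n) \<longlonglongrightarrow> F"
    by (simp add: u_def diff_divide_distrib power_divide)
  then have "(\<lambda>n. mean_ln n / s ^ n) \<longlonglongrightarrow> F"
    by (rule LIMSEQ_imp_Suc)
  moreover have "(mean_ln n - ln s) / s ^ n \<le> F" if "1 \<le> n" for n
    using F(2)[of "n - 1"] that by (simp add: u_def)
  ultimately show ?thesis by blast
qed

text \<open>The variance of \<open>ln R\<close> is of order \<open>s ^ n\<close> and the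
  normalisation divides it by the square of \<open>s ^ n\<close>, so the mean square errors are
  summable.\<close>

lemma AE_free_energy:
  assumes F: "(\<lambda>n. mean_ln n / s ^ n) \<longlonglongrightarrow> F"
  shows "AE x in M. (\<lambda>n. 1 / real s ^ n * ln (R n i x)) \<longlonglongrightarrow> F"
proof -
  define Y where "Y n x = (clip_ln (R (Suc n) i x) - mean_ln (Suc n)) / s ^ Suc n" for n x
  have int: "integrable M (\<lambda>x. (Y n x)\<^sup>2)" for n
    unfolding Y_def power_divide using integrable_square_diff[of "Suc n" i] by simp
  have EY: "expectation (\<lambda>x. (Y n x)\<^sup>2) = var_ln (Suc n) / (s ^ Suc n)\<^sup>2" for n
    unfolding Y_def power_divide var_ln_def
    by (simp add: expectation_R[where f = "\<lambda>y. (clip_ln y - mean_ln (Suc n))\<^sup>2" and i = i])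
  have var: "var_ln (Suc n) \<le> s ^ n * var_ln 1" for n
  proof (induction n)
    case (Suc n)
    have "var_ln (Suc (Suc n)) \<le> s * var_ln (Suc n)" by (rule var_ln_Suc) simp
    also have "\<dots> \<le> s * (s ^ n * var_ln 1)" using Suc by (intro mult_left_mono) auto
    finally show ?case by simp
  qed simp
  have "summable (\<lambda>n. expectation (\<lambda>x. (Y n x)\<^sup>2))"
  proof (rule summable_comparison_test)
    show "summable (\<lambda>n. var_ln 1 * (1 / s) ^ n)"
      using s by (intro summable_mult summable_geometric) auto
    have "var_ln (Suc n) / (s ^ Suc n)\<^sup>2 \<le> var_ln 1 * (1 / s) ^ n" for n
    proof -
      have "var_ln (Suc n) / (s ^ Suc n)\<^sup>2 \<le> s ^ n * var_ln 1 / (s ^ Suc n)\<^sup>2"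
        using var by (intro divide_right_mono) auto
      also have "\<dots> = var_ln 1 * (1 / s) ^ n * (1 / real s ^ 2)"
        using s by (simp add: power2_eq_square power_divide field_simps)
      also have "\<dots> \<le> var_ln 1 * (1 / s) ^ n * 1"
        using s var_ln_nonneg[of 1] by (intro mult_left_mono) (auto simp: divide_simps)
      finally show ?thesis by simp
    qed
    then show "\<exists>N. \<forall>n\<ge>N. norm (expectation (\<lambda>x. (Y n x)\<^sup>2)) \<le> var_ln 1 * (1 / s) ^ n"
      unfolding EY using var_ln_nonneg by (simp add: abs_of_nonneg)
  qed
  then have "AE x in M. (\<lambda>n. Y n x) \<longlonglongrightarrow> 0"
    using int by (intro AE_tendsto_of_summable_square) (auto simp: Y_def)
  then show ?thesis
  proof eventually_elim
    case (elim x)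
    have "(\<lambda>n. mean_ln (Suc n) / s ^ Suc n) \<longlonglongrightarrow> F" using F by (rule LIMSEQ_Suc)
    from tendsto_add[OF elim this] have "(\<lambda>n. clip_ln (R (Suc n) i x) / s ^ Suc n) \<longlonglongrightarrow> F"
      by (simp add: Y_def diff_divide_distrib)
    then have "(\<lambda>n. 1 / real s ^ Suc n * ln (R (Suc n) i x)) \<longlonglongrightarrow> F"
      by (simp add: clip_ln_R)
    then show ?case by (rule LIMSEQ_imp_Suc)
  qed
qed

lemma free_energy_eq:
  assumes F: "(\<lambda>n. mean_ln n / s ^ n) \<longlonglongrightarrow> F"
  shows "(THE F. AE x in M. (\<lambda>n. 1 / real s ^ n * ln (R n i x)) \<longlonglongrightarrow> F) = F"
proof (rule the_equality)
  show "AE x in M. (\<lambda>n. 1 / real s ^ n * ln (R n i x)) \<longlonglongrightarrow> F" by (rule AE_free_energy[OF F])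
next
  fix F' assume "AE x in M. (\<lambda>n. 1 / real s ^ n * ln (R n i x)) \<longlonglongrightarrow> F'"
  with AE_free_energy[OF F, of i] have "AE x in M. F' = F"
    by eventually_elim (rule LIMSEQ_unique)
  then show "F' = F" by simp
qed

lemma mean_ln_ge: "- ln 2 \<le> mean_ln n"
proof -
  have "expectation (\<lambda>x. - ln 2) \<le> mean_ln n"
    unfolding mean_ln_def
  proof (rule integral_mono[OF _ integrable_clip_ln])
    fix x
    have "ln (1 / 2) \<le> clip_ln (R n 0 x)"
      unfolding clip_ln_def by (subst ln_le_cancel_iff) auto
    then show "- ln 2 \<le> clip_ln (R n 0 x)" by (simp add: ln_div)
  qed simp
  then show ?thesis by (simp add: prob_space)
qed

text \<open>Means stay at most \<open>1\<close>, so \<open>ln y \<le> y - 1\<close> gives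
  \<open>mean_ln n \<le> 0\<close> for \<open>n \<ge> 1\<close>; the lower bound
  \<open>- ln 2\<close> disappears in the limit.\<close>

lemma free_energy_subcritical:
  assumes "mean 0 \<le> 1"
  shows "(\<lambda>n. mean_ln n / s ^ n) \<longlonglongrightarrow> 0"
proof -
  have mean: "mean n \<le> 1" for n
  proof (induction n)
    case (Suc n)
    have "mean n ^ s \<le> 1" using Suc mean_pos[of n] by (intro power_le_one) auto
    then show ?case using s unfolding mean_Suc by (simp add: divide_le_eq)
  qed (rule assms)
  have up: "mean_ln n \<le> 0" if n: "1 \<le> n" for n
  proof -
    have "mean_ln n \<le> expectation (\<lambda>x. R n 0 x - 1)"
      unfolding mean_ln_def using n
      by (intro integral_mono integrable_clip_ln) (auto simp: clip_ln_R intro!: ln_le_minus_one)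
    also have "\<dots> = mean n - 1" by (simp add: prob_space mean_def)
    finally show ?thesis using mean[of n] by simp
  qed
  have "(\<lambda>n. - ln 2 * (1 / real s) ^ n) \<longlonglongrightarrow> - ln 2 * 0"
    using s by (intro tendsto_mult_left LIMSEQ_power_zero) auto
  then have low: "(\<lambda>n. - ln 2 * (1 / real s) ^ n) \<longlonglongrightarrow> 0" by simp
  show ?thesis
  proof (rule real_tendsto_sandwich[OF _ _ low tendsto_const])
    show "\<forall>\<^sub>F n in sequentially. - ln 2 * (1 / real s) ^ n \<le> mean_ln n / s ^ n"
    proof (intro always_eventually allI)
      fix n
      have "- ln 2 / s ^ n \<le> mean_ln n / s ^ n" using mean_ln_ge by (intro divide_right_mono) auto
      then show "- ln 2 * (1 / real s) ^ n \<le> mean_ln n / s ^ n" by (simp add: power_divide)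
    qed
    show "\<forall>\<^sub>F n in sequentially. mean_ln n / s ^ n \<le> 0"
      using eventually_ge_at_top[of 1] by eventually_elim (simp add: up divide_nonpos_nonneg)
  qed
qed

text \<open>Integrate the pointwise minorant \<open>ln (r / 2) - ln r / c * \<phi> x\<close> of the
  clipped logarithm: where \<open>R\<close> is at most half its mean, \<open>\<phi> \<ge> c\<close>
  pushes it down to \<open>- ln 2\<close>; elsewhere \<open>\<phi> \<ge> 0\<close> suffices. The
  result exceeds \<open>ln r / 2 - ln 2\<close>, and \<open>r > 4 * s\<^sup>2\<close> makes this
  larger than \<open>ln s\<close>.\<close>

lemma mean_ln_large:
  assumes p: "1 < p" "p \<le> 2" and n: "1 \<le> n" and mean: "4 * (real s)\<^sup>2 < mean n"
    and dev: "dev p n < ((1/2) powr p - 1 + p / 2) / 2"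
  shows "ln s < mean_ln n"
proof -
  define r where "r = mean n"
  define c where "c = (1/2) powr p - 1 + p / 2"
  define \<phi> where "\<phi> x = (R n 0 x / r) powr p - 1 - p * (R n 0 x / r - 1)" for x
  have c: "0 < c" unfolding c_def by (rule powr_deviation_half_pos[OF p(1)])
  have "1 \<le> real s ^ 2" using s by (intro one_le_power) auto
  then have r: "2 < r" "0 < r" "4 * (real s)\<^sup>2 < r" using mean by (auto simp: r_def)
  have int: "integrable M \<phi>" and E: "expectation \<phi> = dev p n"
    unfolding \<phi>_def r_def using dev_bound[OF p] by auto
  have "ln (r / 2) - ln r / c * dev p n = expectation (\<lambda>x. ln (r / 2) - ln r / c * \<phi> x)"
    using int by (simp add: E prob_space)
  also have "\<dots> \<le> mean_ln n"
    unfolding mean_ln_def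
  proof (rule integral_mono[OF _ integrable_clip_ln])
    show "integrable M (\<lambda>x. ln (r / 2) - ln r / c * \<phi> x)" using int by simp
    fix x
    have lr: "0 < ln r" using r by simp
    show "ln (r / 2) - ln r / c * \<phi> x \<le> clip_ln (R n 0 x)"
    proof (cases "R n 0 x / r \<le> 1 / 2")
      case True
      then have "c \<le> \<phi> x"
        unfolding \<phi>_def c_def using r by (intro powr_deviation_half_le p) auto
      then have "ln r / c * c \<le> ln r / c * \<phi> x" using lr c by (intro mult_left_mono) auto
      then have "ln (r / 2) - ln r / c * \<phi> x \<le> - ln 2" using c r by (simp add: ln_div)
      also have "- ln 2 = ln (1 / 2 :: real)" by (simp add: ln_div)
      also have "\<dots> \<le> clip_ln (R n 0 x)" unfolding clip_ln_def by (subst ln_le_cancel_iff) auto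
      finally show ?thesis .
    next
      case False
      then have "r / 2 \<le> R n 0 x" using r by (simp add: field_simps)
      then have "ln (r / 2) \<le> ln (R n 0 x)" using r by (subst ln_le_cancel_iff) auto
      moreover have "0 \<le> \<phi> x" unfolding \<phi>_def using r by (intro powr_deviation_nonneg p) auto
      moreover from this have "0 \<le> ln r / c * \<phi> x" using lr c by simp
      ultimately show ?thesis unfolding clip_ln_R[OF n] by linarith
    qed
  qed
  finally have "ln (r / 2) - ln r / c * dev p n \<le> mean_ln n" .
  moreover have "ln r / c * dev p n \<le> ln r / c * (c / 2)"
    using dev c r by (intro mult_left_mono) (auto simp: c_def)
  moreover have "ln r / c * (c / 2) = ln r / 2" using c by simp
  moreover have "2 * ln s + 2 * ln 2 < ln r"
  proof -
    have "ln (4 * (real s)\<^sup>2) < ln r" using r s by (subst ln_less_cancel_iff) auto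
    moreover have "ln (4 * (real s)\<^sup>2) = 2 * ln s + ln (2 ^ 2)" using s by (simp add: ln_mult ln_realpow)
    moreover have "ln (2 ^ 2) = 2 * ln (2::real)" by (subst ln_realpow) auto
    ultimately show ?thesis by linarith
  qed
  ultimately show ?thesis using r by (simp add: ln_div)
qed

end

section \<open>Decay of the entropy at criticality\<close>

lemma abs_mult_ln_le:
  fixes y :: real
  assumes "0 < y"
  shows "\<bar>y * ln y\<bar> \<le> 1 * (1 + y\<^sup>2)"
proof -
  have "y * ln y \<le> y * (y - 1)" using ln_le_minus_one[OF assms] assms by (intro mult_left_mono) auto
  moreover have "y * (- ln y) \<le> y * (1 / y - 1)"
    using ln_le_minus_one[of "1 / y"] assms by (intro mult_left_mono) (auto simp: ln_div)
  ultimately have "y * ln y \<le> y\<^sup>2 - y" "- (y * ln y) \<le> 1 - y"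
    using assms by (simp_all add: power2_eq_square algebra_simps)
  moreover have "0 \<le> y\<^sup>2" by simp
  ultimately have "y * ln y \<le> 1 + y\<^sup>2" "- (y * ln y) \<le> 1 + y\<^sup>2" using assms by linarith+
  then show ?thesis by (simp add: abs_le_iff)
qed

text \<open>The positive part of the logarithm. Being nonnegative, it is subadditive over products
  in a way that survives squaring.\<close>

definition pos_ln :: "real \<Rightarrow> real" where
  "pos_ln y = ln (max y 1)"

lemma pos_ln_nonneg [simp]: "0 \<le> pos_ln y"
  by (simp add: pos_ln_def)

lemma measurable_pos_ln [measurable]: "pos_ln \<in> borel_measurable borel"
  unfolding pos_ln_def by measurable

lemma mult_pos_ln_square_le:
  fixes y :: real
  assumes "0 < y"
  shows "y * (pos_ln y)\<^sup>2 \<le> 4 * y\<^sup>2"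
proof -
  have "(pos_ln y)\<^sup>2 \<le> 4 * y"
  proof (cases "1 \<le> y")
    case True
    have "ln y = 2 * ln (sqrt y)" using assms by (simp add: ln_sqrt)
    also have "\<dots> \<le> 2 * sqrt y" using ln_le_minus_one[of "sqrt y"] assms by simp
    finally have "(ln y)\<^sup>2 \<le> (2 * sqrt y)\<^sup>2" using True by (intro power_mono) auto
    then show ?thesis using True assms by (simp add: pos_ln_def max_absorb1 power_mult_distrib)
  qed (use assms in \<open>simp add: pos_ln_def max_absorb2\<close>)
  then have "y * (pos_ln y)\<^sup>2 \<le> y * (4 * y)" using assms by (intro mult_left_mono) auto
  then show ?thesis by (simp add: power2_eq_square mult.assoc)
qed

lemma mult_pos_ln_le:
  fixes y :: real
  assumes "0 < y"
  shows "y * pos_ln y \<le> y * ln y + 1"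
proof -
  have "y * (- ln y) \<le> y * (1 / y - 1)"
    using ln_le_minus_one[of "1 / y"] assms by (intro mult_left_mono) (auto simp: ln_div)
  then have "- (y * ln y) \<le> 1" using assms by (simp add: algebra_simps)
  then show ?thesis by (simp add: pos_ln_def max_def)
qed

text \<open>For \<open>x \<ge> 1\<close> one has \<open>1 \<le> y \<le> x\<close>, and the entropy
  inequality is multiplied by \<open>ln y \<le> ln x\<close>. For \<open>x < 1\<close> both sides
  vanish.\<close>

lemma pos_ln_step:
  fixes x :: real
  assumes s: "2 \<le> (s::nat)" and x: "0 < x"
  defines "y \<equiv> (x + real s - 1) / s"
  shows "y * (pos_ln y)\<^sup>2 \<le> x * (pos_ln x)\<^sup>2 / s"
proof (cases "1 \<le> x")
  case True
  have "real s - 1 \<le> (real s - 1) * x" using True s mult_left_mono[of 1 x "real s - 1"] by simp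
  then have y: "1 \<le> y" "y \<le> x" using True s by (auto simp: y_def divide_simps algebra_simps)
  have "y * ln y * ln y \<le> x * ln x / s * ln x"
    using entropy_step_le(1)[OF s x] y True s unfolding y_def[symmetric]
    by (intro mult_mono) auto
  then show ?thesis using y True by (simp add: pos_ln_def max_absorb1 power2_eq_square mult.assoc)
next
  case False
  then have "y \<le> 1" using s by (simp add: y_def divide_le_eq)
  then show ?thesis using x by (simp add: pos_ln_def max_absorb2)
qed

lemma pos_ln_prod_le:
  assumes "finite I" "\<And>i. i \<in> I \<Longrightarrow> (0::real) < y i"
  shows "pos_ln (\<Prod>i\<in>I. y i) \<le> (\<Sum>i\<in>I. pos_ln (y i))"
proof -
  have "ln (\<Prod>i\<in>I. y i) = (\<Sum>i\<in>I. ln (y i))"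
    using assms by (intro ln_prod) (auto dest: less_imp_neq[THEN not_sym])
  also have "\<dots> \<le> (\<Sum>i\<in>I. pos_ln (y i))"
    using assms(2) by (intro sum_mono) (auto simp: pos_ln_def max_def)
  finally show ?thesis
    unfolding pos_ln_def[of "prod y I"] by (auto simp: max_def sum_nonneg)
qed

text \<open>
  For \<open>x \<ge> K\<close> this is \<open>l \<le> l\<^sup>2 / (4 a) + a\<close> with \<open>l = ln x\<close>, where the term \<open>a x\<close> is paid for by the entropy
  lost in one step. In expectation it bounds that loss from below, with \<open>a\<close> chosen of order \<open>n\<close>.
\<close>

lemma entropy_tradeoff:
  fixes K a c x :: real
  assumes s: "2 \<le> (s::nat)" and K: "1 < K" and a: "0 < a" and c: "0 < c" and x: "0 < x"
    and gap: "\<And>x. K \<le> x \<Longrightarrow> c * x \<le> x * ln x / s - (x + real s - 1) / s * ln ((x + real s - 1) / s)"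
  shows "x * ln x \<le> ln K * x + x * (pos_ln x)\<^sup>2 / (4 * a)
    + a / c * (x * ln x / s - (x + real s - 1) / s * ln ((x + real s - 1) / s))" (is "_ \<le> _ + _ + a / c * ?g")
proof (cases "K \<le> x")
  case True
  have "ln x = pos_ln x" using True K by (simp add: pos_ln_def max_absorb1)
  moreover have "pos_ln x \<le> (pos_ln x)\<^sup>2 / (4 * a) + a"
    using a zero_le_power2[of "pos_ln x - 2 * a"] by (simp add: field_simps power2_eq_square)
  ultimately have "x * ln x \<le> x * ((pos_ln x)\<^sup>2 / (4 * a) + a)"
    using x by (intro mult_left_mono) auto
  also have "\<dots> = x * (pos_ln x)\<^sup>2 / (4 * a) + a / c * (c * x)" using c by (simp add: algebra_simps)
  also have "\<dots> \<le> x * (pos_ln x)\<^sup>2 / (4 * a) + a / c * ?g"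
    using gap[OF True] a c by (intro add_left_mono mult_left_mono) auto
  finally show ?thesis using K x by (simp add: add_increasing add.assoc)
next
  case False
  then have "ln x \<le> ln K" using x K by (subst ln_le_cancel_iff) auto
  then have "x * ln x \<le> ln K * x" using x by (simp add: mult.commute)
  moreover have "0 \<le> a / c * ?g" using entropy_step_le(1)[OF s x] a c by (intro mult_nonneg_nonneg) auto
  moreover have "0 \<le> x * (pos_ln x)\<^sup>2 / (4 * a)" using x a by simp
  ultimately show ?thesis by linarith
qed

context hierarchical_iid
begin

text \<open>At mean \<open>1\<close> this is the relative entropy of the measure with density
  \<open>R n 0\<close> with respect to \<open>M\<close>.\<close>

definition mean_entropy :: "nat \<Rightarrow> real" where
  "mean_entropy n = expectation (\<lambda>x. R n 0 x * ln (R n 0 x))"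

definition mean_entropy2 :: "nat \<Rightarrow> real" where
  "mean_entropy2 n = expectation (\<lambda>x. R n 0 x * (pos_ln (R n 0 x))\<^sup>2)"

lemma integrable_entropy: "integrable M (\<lambda>x. R n i x * ln (R n i x))"
  using abs_mult_ln_le by (intro integrable_dominated[where C = 1]) auto

lemma integrable_entropy2: "integrable M (\<lambda>x. R n i x * (pos_ln (R n i x))\<^sup>2)"
proof (rule integrable_dominated)
  show "\<bar>y * (pos_ln y)\<^sup>2\<bar> \<le> 4 * (1 + y\<^sup>2)" if "0 < y" for y
    using mult_pos_ln_square_le[OF that] that by simp
qed auto

lemma integrable_pos_entropy: "integrable M (\<lambda>x. R n i x * pos_ln (R n i x))"
proof (rule integrable_dominated)
  show "\<bar>y * pos_ln y\<bar> \<le> 2 * (1 + y\<^sup>2)" if "0 < y" for y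
  proof -
    have "y * pos_ln y \<le> y * ln y + 1" by (rule mult_pos_ln_le[OF that])
    also have "y * ln y \<le> 1 + y\<^sup>2" using abs_le_D1[OF abs_mult_ln_le[OF that]] by simp
    also have "1 + y\<^sup>2 + 1 \<le> 2 * (1 + y\<^sup>2)" by simp
    finally show ?thesis using that by (simp add: abs_of_nonneg)
  qed
qed auto

section \<open>Entropy decay when the mean is 1, that is, at \<open>h = 0\<close>\<close>

context
  assumes mean0: "mean 0 = 1"
begin

lemma mean_eq_1: "mean n = 1"
  using s by (induction n) (auto simp: mean0 mean_Suc)

lemma entropy_nonneg: "0 \<le> mean_entropy n"
proof -
  have "expectation (\<lambda>x. R n 0 x - 1) \<le> mean_entropy n"
    unfolding mean_entropy_def
  proof (rule integral_mono[OF _ integrable_entropy])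
    fix x
    have "R n 0 x * (- ln (R n 0 x)) \<le> R n 0 x * (1 / R n 0 x - 1)"
      using ln_le_minus_one[of "1 / R n 0 x"] by (intro mult_left_mono) (auto simp: ln_div)
    then show "R n 0 x - 1 \<le> R n 0 x * ln (R n 0 x)" by (simp add: algebra_simps)
  qed simp
  then show ?thesis using mean_eq_1[of n] by (simp add: prob_space mean_def)
qed

text \<open>The logarithm splits into \<open>s\<close> terms; in each, all factors but one integrate
  to \<open>1\<close>.\<close>

lemma
  shows integrable_entropy_X: "integrable M (\<lambda>x. X n x * ln (X n x))"
    and expectation_entropy_X: "expectation (\<lambda>x. X n x * ln (X n x)) = s * mean_entropy n"
proof -
  have id: "(\<lambda>y::real. y) \<in> borel_measurable borel" and ln: "(ln :: real \<Rightarrow> real) \<in> borel_measurable borel"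
    by measurable
  note w = id integrable_R mean_eq_1[unfolded mean_def] ln integrable_entropy
  have eq: "X n x * ln (X n x) = (\<Sum>j=1..s. X n x * ln (R n j x))" for x
    by (subst ln_prod) (auto simp: sum_distrib_left)
  show "integrable M (\<lambda>x. X n x * ln (X n x))"
    unfolding eq by (intro Bochner_Integration.integrable_sum integrable_weighted[OF w])
  have "expectation (\<lambda>x. X n x * ln (X n x)) = (\<Sum>j=1..s. expectation (\<lambda>x. X n x * ln (R n j x)))"
    unfolding eq by (intro Bochner_Integration.integral_sum integrable_weighted[OF w])
  also have "\<dots> = (\<Sum>j=1..s. mean_entropy n)"
    unfolding mean_entropy_def by (intro sum.cong refl expectation_weighted[OF w])
  finally show "expectation (\<lambda>x. X n x * ln (X n x)) = s * mean_entropy n" by simp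
qed

lemma
  shows integrable_entropy2_X: "integrable M (\<lambda>x. X n x * (pos_ln (X n x))\<^sup>2)"
    and expectation_entropy2_X_le:
      "expectation (\<lambda>x. X n x * (pos_ln (X n x))\<^sup>2) \<le> s * mean_entropy2 n + s * real s * (mean_entropy n + 1)\<^sup>2"
proof -
  have id: "(\<lambda>y::real. y) \<in> borel_measurable borel" by measurable
  note w = id integrable_R mean_eq_1[unfolded mean_def] measurable_pos_ln integrable_pos_entropy integrable_entropy2
  let ?S = "\<lambda>x. \<Sum>j=1..s. pos_ln (R n j x)"
  have int: "integrable M (\<lambda>x. X n x * (?S x)\<^sup>2)" by (rule integrable_weighted_square[OF w])
  have "(pos_ln (X n x))\<^sup>2 \<le> (?S x)\<^sup>2" for x
    by (intro power_mono pos_ln_prod_le) auto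
  then have le: "X n x * (pos_ln (X n x))\<^sup>2 \<le> X n x * (?S x)\<^sup>2" for x
    using X_pos[of n x] by (intro mult_left_mono) auto
  show int': "integrable M (\<lambda>x. X n x * (pos_ln (X n x))\<^sup>2)"
  proof (rule Bochner_Integration.integrable_bound[OF int])
    show "AE x in M. norm (X n x * (pos_ln (X n x))\<^sup>2) \<le> norm (X n x * (?S x)\<^sup>2)"
      using le X_pos[of n] by (intro AE_I2) (simp add: abs_mult)
  qed measurable
  define E where "E = expectation (\<lambda>x. R n 0 x * pos_ln (R n 0 x))"
  have "0 \<le> E" unfolding E_def by (intro Bochner_Integration.integral_nonneg) auto
  moreover have "E \<le> expectation (\<lambda>x. R n 0 x * ln (R n 0 x) + 1)"
    unfolding E_def using integrable_entropy integrable_pos_entropy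
    by (intro integral_mono mult_pos_ln_le) auto
  then have "E \<le> mean_entropy n + 1" using integrable_entropy by (simp add: prob_space mean_entropy_def)
  ultimately have E2: "E\<^sup>2 \<le> (mean_entropy n + 1)\<^sup>2" by (intro power_mono) auto
  have "expectation (\<lambda>x. X n x * (pos_ln (X n x))\<^sup>2) \<le> expectation (\<lambda>x. X n x * (?S x)\<^sup>2)"
    by (rule integral_mono[OF int' int le])
  also have "\<dots> = s * mean_entropy2 n + s * (real s - 1) * E\<^sup>2"
    unfolding mean_entropy2_def E_def by (rule expectation_weighted_square[OF w])
  also have "s * (real s - 1) * E\<^sup>2 \<le> s * real s * (mean_entropy n + 1)\<^sup>2"
    using E2 s by (intro mult_mono) auto
  finally show "expectation (\<lambda>x. X n x * (pos_ln (X n x))\<^sup>2)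
      \<le> s * mean_entropy2 n + s * real s * (mean_entropy n + 1)\<^sup>2" by simp
qed

lemma entropy_Suc_le: "mean_entropy (Suc n) \<le> mean_entropy n"
proof -
  have "mean_entropy (Suc n) \<le> expectation (\<lambda>x. X n x * ln (X n x) / s)"
    unfolding mean_entropy_def[of "Suc n"]
  proof (rule integral_mono[OF integrable_entropy])
    show "integrable M (\<lambda>x. X n x * ln (X n x) / s)" using integrable_entropy_X by simp
    show "R (Suc n) 0 x * ln (R (Suc n) 0 x) \<le> X n x * ln (X n x) / s" for x
      unfolding R_Suc_0 by (rule entropy_step_le(1)[OF s X_pos])
  qed
  also have "\<dots> = mean_entropy n" using expectation_entropy_X[of n] s by simp
  finally show ?thesis .
qed

lemma entropy_le: "mean_entropy n \<le> mean_entropy 0"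
  using entropy_Suc_le by (induction n) (auto intro: order_trans)

text \<open>The product step sends \<open>mean_entropy2 n\<close> to at most
  \<open>s * mean_entropy2 n + c\<close>, where \<open>c\<close> is uniform because the entropy is
  bounded; mixing divides by \<open>s\<close>. Hence \<open>s * mean_entropy2 n\<close> gains at
  most \<open>c\<close> per generation.\<close>

lemma entropy2_X_linear:
  "\<exists>B::real. 0 < B \<and> (\<forall>n. expectation (\<lambda>x. X n x * (pos_ln (X n x))\<^sup>2) \<le> B * real (n + 1))"
proof -
  define c where "c = s * real s * (mean_entropy 0 + 1)\<^sup>2"
  have c: "0 \<le> c" by (simp add: c_def)
  have step: "expectation (\<lambda>x. X n x * (pos_ln (X n x))\<^sup>2) \<le> s * mean_entropy2 n + c" for n
  proof -
    have "(mean_entropy n + 1)\<^sup>2 \<le> (mean_entropy 0 + 1)\<^sup>2"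
      using entropy_le[of n] entropy_nonneg[of n] by (intro power_mono) auto
    then have "s * real s * (mean_entropy n + 1)\<^sup>2 \<le> c" unfolding c_def by (intro mult_left_mono) auto
    then show ?thesis using expectation_entropy2_X_le[of n] by linarith
  qed
  have "s * mean_entropy2 (Suc n) \<le> s * mean_entropy2 n + c" for n
  proof -
    have "mean_entropy2 (Suc n) \<le> expectation (\<lambda>x. X n x * (pos_ln (X n x))\<^sup>2 / s)"
      unfolding mean_entropy2_def
    proof (rule integral_mono[OF integrable_entropy2])
      show "integrable M (\<lambda>x. X n x * (pos_ln (X n x))\<^sup>2 / s)" using integrable_entropy2_X by simp
      show "R (Suc n) 0 x * (pos_ln (R (Suc n) 0 x))\<^sup>2 \<le> X n x * (pos_ln (X n x))\<^sup>2 / s" for x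
        unfolding R_Suc_0 by (rule pos_ln_step[OF s X_pos])
    qed
    then have "s * mean_entropy2 (Suc n) \<le> expectation (\<lambda>x. X n x * (pos_ln (X n x))\<^sup>2)"
      using s by (simp add: field_simps)
    then show ?thesis using step[of n] by simp
  qed
  note step2 = this
  have lin: "s * mean_entropy2 n \<le> s * mean_entropy2 0 + n * c" for n
  proof (induction n)
    case (Suc n)
    then show ?case using step2[of n] by (simp add: distrib_right)
  qed simp
  define B where "B = \<bar>s * mean_entropy2 0\<bar> + c + 1"
  have "expectation (\<lambda>x. X n x * (pos_ln (X n x))\<^sup>2) \<le> B * real (n + 1)" for n
  proof -
    have "expectation (\<lambda>x. X n x * (pos_ln (X n x))\<^sup>2) \<le> s * mean_entropy2 0 + (n + 1) * c"
      using step[of n] lin[of n] by (simp add: algebra_simps)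
    also have "s * mean_entropy2 0 \<le> \<bar>s * mean_entropy2 0\<bar> * (n + 1)"
      using mult_left_mono[of 1 "real (n + 1)" "\<bar>s * mean_entropy2 0\<bar>"]
        abs_ge_self[of "s * mean_entropy2 0"] by linarith
    also have "\<bar>s * mean_entropy2 0\<bar> * (n + 1) + (n + 1) * c \<le> B * real (n + 1)"
      by (simp add: B_def algebra_simps)
    finally show ?thesis by simp
  qed
  moreover have "0 < B" using c by (simp add: B_def add_nonneg_pos)
  ultimately show ?thesis by (intro exI[of _ B] conjI allI)
qed

text \<open>Integrated form of the pointwise trade-off. The expected loss is the entropy drop,
  because \<open>X n x * ln (X n x) / s\<close> has expectation
  \<open>mean_entropy n\<close>.\<close>

lemma entropy_gain:
  assumes K: "1 < K" and a: "0 < a" and c: "0 < c"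
    and gap: "\<And>x. K \<le> x \<Longrightarrow> c * x \<le> x * ln x / s - (x + real s - 1) / s * ln ((x + real s - 1) / s)"
  shows "s * mean_entropy n \<le> ln K + expectation (\<lambda>x. X n x * (pos_ln (X n x))\<^sup>2) / (4 * a)
    + a / c * (mean_entropy n - mean_entropy (Suc n))"
proof -
  let ?g = "\<lambda>x. X n x * ln (X n x) / s - R (Suc n) 0 x * ln (R (Suc n) 0 x)"
  have int: "integrable M (\<lambda>x. X n x * ln (X n x) / s)" "integrable M (\<lambda>x. R (Suc n) 0 x * ln (R (Suc n) 0 x))"
    "integrable M (\<lambda>x. X n x * (pos_ln (X n x))\<^sup>2 / (4 * a))" "integrable M (\<lambda>x. ln K * X n x)"
    using integrable_entropy_X integrable_entropy integrable_entropy2_X integrable_X by auto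
  have intg: "integrable M (\<lambda>x. a / c * ?g x)" using int by (intro integrable_mult_right Bochner_Integration.integrable_diff)
  have "s * mean_entropy n \<le> expectation (\<lambda>x. ln K * X n x + X n x * (pos_ln (X n x))\<^sup>2 / (4 * a) + a / c * ?g x)"
    unfolding expectation_entropy_X[symmetric]
  proof (rule integral_mono[OF integrable_entropy_X])
    show "integrable M (\<lambda>x. ln K * X n x + X n x * (pos_ln (X n x))\<^sup>2 / (4 * a) + a / c * ?g x)"
      by (intro Bochner_Integration.integrable_add int intg)
    show "X n x * ln (X n x) \<le> ln K * X n x + X n x * (pos_ln (X n x))\<^sup>2 / (4 * a) + a / c * ?g x" for x
      unfolding R_Suc_0 by (rule entropy_tradeoff[OF s K a c X_pos gap])
  qed
  also have "\<dots> = expectation (\<lambda>x. ln K * X n x)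
      + expectation (\<lambda>x. X n x * (pos_ln (X n x))\<^sup>2 / (4 * a)) + expectation (\<lambda>x. a / c * ?g x)"
    using int intg by (simp only: Bochner_Integration.integral_add Bochner_Integration.integrable_add)
  also have "expectation (\<lambda>x. ln K * X n x) = ln K"
    using expectation_X[of n] mean_eq_1[of n] by simp
  also have "expectation (\<lambda>x. X n x * (pos_ln (X n x))\<^sup>2 / (4 * a))
      = expectation (\<lambda>x. X n x * (pos_ln (X n x))\<^sup>2) / (4 * a)"
    by (rule integral_divide_zero)
  also have "expectation (\<lambda>x. a / c * ?g x) = a / c * (mean_entropy n - mean_entropy (Suc n))"
  proof -
    have "expectation ?g = expectation (\<lambda>x. X n x * ln (X n x) / s) - mean_entropy (Suc n)"
      unfolding mean_entropy_def by (rule Bochner_Integration.integral_diff[OF int(1,2)])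
    also have "expectation (\<lambda>x. X n x * ln (X n x) / s) = mean_entropy n"
      using expectation_entropy_X[of n] s by simp
    finally show ?thesis by simp
  qed
  finally show ?thesis .
qed

lemma entropy_small:
  assumes t: "0 < t"
  shows "\<exists>n. mean_entropy n < t"
proof (rule ccontr)
  assume "\<not> (\<exists>n. mean_entropy n < t)"
  then have ge: "t \<le> mean_entropy n" for n by (simp add: not_less)
  from entropy2_X_linear obtain B :: real
    where B': "0 < B \<and> (\<forall>n. expectation (\<lambda>x. X n x * (pos_ln (X n x))\<^sup>2) \<le> B * real (n + 1))" ..
  note B = conjunct1[OF B'] spec[OF conjunct2[OF B']]
  \<comment> \<open>Since \<open>s \<ge> 2\<close>, the left side of the trade-off is at least
    \<open>2 * t\<close>. The choices of \<open>K\<close> and of \<open>a\<close> below each use up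
    \<open>t / 2\<close>, leaving \<open>t\<close> for the entropy drop.\<close>
  define K where "K = exp (t / 2)"
  have K: "1 < K" using t by (simp add: K_def)
  obtain c where c: "0 < c"
    "\<And>x. K \<le> x \<Longrightarrow> c * x \<le> x * ln x / s - (x + real s - 1) / s * ln ((x + real s - 1) / s)"
    using entropy_gap[OF s K] by blast
  define \<kappa> where "\<kappa> = 2 * t * t * c / B"
  have \<kappa>: "0 < \<kappa>" using t c B(1) by (simp add: \<kappa>_def)
  have drop: "\<kappa> * (1 / real (n + 1)) \<le> mean_entropy n - mean_entropy (Suc n)" for n
  proof -
    define a where "a = B * real (n + 1) / (2 * t)"
    have a: "0 < a" using B(1) t by (simp add: a_def)
    have "2 * t \<le> s * mean_entropy n" using s t ge[of n] by (intro mult_mono) auto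
    also have "\<dots> \<le> ln K + expectation (\<lambda>x. X n x * (pos_ln (X n x))\<^sup>2) / (4 * a)
        + a / c * (mean_entropy n - mean_entropy (Suc n))"
      by (rule entropy_gain[OF K a c])
    also have "expectation (\<lambda>x. X n x * (pos_ln (X n x))\<^sup>2) / (4 * a) \<le> B * real (n + 1) / (4 * a)"
      using B(2) a by (intro divide_right_mono) auto
    also have "B * real (n + 1) / (4 * a) = t / 2" using B(1) t by (simp add: a_def)
    finally have "t \<le> a / c * (mean_entropy n - mean_entropy (Suc n))" by (simp add: K_def)
    then have "c / a * t \<le> c / a * (a / c * (mean_entropy n - mean_entropy (Suc n)))"
      using a c by (intro mult_left_mono) auto
    then have "c / a * t \<le> mean_entropy n - mean_entropy (Suc n)" using a c by simp
    moreover have "c / a * t = \<kappa> * (1 / real (n + 1))" using B(1) t by (simp add: a_def \<kappa>_def)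
    ultimately show ?thesis by simp
  qed
  \<comment> \<open>Telescoping: as the entropy is nonnegative, this bounds the partial sums of a
    multiple of the harmonic series.\<close>
  have "(\<Sum>i<n. \<kappa> * (1 / real (i + 1))) \<le> mean_entropy 0 - mean_entropy n" for n
  proof (induction n)
    case (Suc n)
    then show ?case using drop[of n] by simp
  qed simp
  then have "(\<Sum>i<n. \<kappa> * (1 / real (i + 1))) \<le> mean_entropy 0" for n
    using entropy_nonneg[of n] by (smt (verit))
  then have "summable (\<lambda>i. \<kappa> * (1 / real (i + 1)))"
    using \<kappa> by (intro bounded_imp_summable[of _ "mean_entropy 0"])
      (auto simp: lessThan_Suc_atMost[symmetric] simp del: sum.lessThan_Suc)
  from summable_mult[OF this, of "1 / \<kappa>"] have "summable (\<lambda>i. 1 / real (Suc i))"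
    using \<kappa> by simp
  then have "summable (\<lambda>i. inverse (real i))"
    by (subst (asm) summable_Suc_iff) (simp add: inverse_eq_divide)
  then show False using not_summable_harmonic[where 'a = real] by simp
qed

lemma dev_small:
  "\<exists>p. 1 < p \<and> p \<le> 2 \<and> (\<forall>\<epsilon>>0. \<exists>n. dev p n < \<epsilon>)"
proof -
  define c where "c = ln s / (4 * real s)"
  have c: "0 < c" using s by (simp add: c_def)
  obtain n where n: "mean_entropy n < c" using entropy_small[OF c] by blast
  define Q where "Q = 8 * (1 + expectation (\<lambda>x. (R n 0 x)\<^sup>2))"
  have Q: "0 < Q" unfolding Q_def by (smt (verit) Bochner_Integration.integral_nonneg zero_le_power2)
  \<comment> \<open>The generation \<open>n\<close> is fixed first, and \<open>g\<close> is then
    adapted to its second moment. Entropy and remainder contribute at most \<open>c\<close> each,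
    and \<open>2 * c * g\<close> is the threshold of the contraction lemma.\<close>
  define g where "g = min (1 / 4) (c / Q)"
  have g: "0 < g" "g \<le> 1 / 4" "g * Q \<le> c"
    using c Q by (auto simp: g_def min_def field_simps)
  have p: "1 < 1 + g" "1 + g \<le> 2" using g by auto
  have "expectation (\<lambda>x. R n 0 x powr (1 + g))
      \<le> expectation (\<lambda>x. R n 0 x + g * (R n 0 x * ln (R n 0 x)) + g\<^sup>2 * (8 * (1 + (R n 0 x)\<^sup>2)))"
    using p integrable_entropy square_integrable[of n] integrable_powr[of "1 + g" n 0] powr_expansion[OF pos g(1,2)]
    by (intro integral_mono) auto
  also have "\<dots> = 1 + g * mean_entropy n + g\<^sup>2 * Q"
    using integrable_entropy square_integrable[of n] mean_eq_1[of n]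
    by (simp add: prob_space mean_entropy_def mean_def Q_def)
  finally have "dev (1 + g) n \<le> g * (mean_entropy n + g * Q)"
    using mean_eq_1[of n] by (simp add: dev_def power2_eq_square algebra_simps)
  also have "\<dots> \<le> g * (c + c)" using n g by (intro mult_left_mono) auto
  also have "\<dots> = g * ln s / (2 * real s)" by (simp add: c_def)
  finally have D0: "dev (1 + g) n \<le> g * ln s / (2 * real s)" .
  have D: "dev (1 + g) (Suc m) \<le> (1 / s) powr (1 + g) * ((1 + dev (1 + g) m) ^ s - 1)" for m
    using dev_Suc[OF p, of m] by (simp add: mean_eq_1)
  have "\<exists>m. dev (1 + g) m < \<epsilon>" if "0 < \<epsilon>" for \<epsilon>
    using deviation_vanishes[where D = "dev (1 + g)", OF s g(1) dev_nonneg[OF p] D D0 that] by blast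
  then show ?thesis using p by blast
qed

end

end

section \<open>The critical point\<close>

lemma partition_fun_nonneg: "0 < s \<Longrightarrow> 0 \<le> partition_fun P \<omega> s \<beta> h n i x"
  by (induction n arbitrary: i) (auto intro!: divide_nonneg_nonneg add_nonneg_nonneg prod_nonneg simp: add_diff_eq[symmetric])

lemma partition_fun_mono:
  assumes s: "0 < s" and h: "h \<le> h'"
  shows "partition_fun P \<omega> s \<beta> h n i x \<le> partition_fun P \<omega> s \<beta> h' n i x"
proof (induction n arbitrary: i)
  case (Suc n)
  have "(\<Prod>j=1..s. partition_fun P \<omega> s \<beta> h n (s * i + j) x) \<le> (\<Prod>j=1..s. partition_fun P \<omega> s \<beta> h' n (s * i + j) x)"
    using Suc partition_fun_nonneg[OF s] by (intro prod_mono) auto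
  then show ?case using s by (simp add: divide_right_mono)
qed (simp add: h)

text \<open>The product turns \<open>s\<close> factors \<open>exp (h * s ^ n)\<close> into one
  \<open>exp (h * s ^ Suc n)\<close>; this is at least \<open>1\<close>, so it may also be put in
  front of the added \<open>s - 1\<close>.\<close>

lemma partition_fun_le:
  assumes s: "0 < s" and h: "0 \<le> h"
  shows "partition_fun P \<omega> s \<beta> h n i x \<le> exp (h * s ^ n) * partition_fun P \<omega> s \<beta> 0 n i x"
proof (induction n arbitrary: i)
  case (Suc n)
  let ?e = "exp (h * s ^ Suc n)"
  let ?X = "\<lambda>h. \<Prod>j=1..s. partition_fun P \<omega> s \<beta> h n (s * i + j) x"
  have "?X h \<le> (\<Prod>j=1..s. exp (h * s ^ n) * partition_fun P \<omega> s \<beta> 0 n (s * i + j) x)"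
    using Suc partition_fun_nonneg[OF s] by (intro prod_mono) auto
  also have "\<dots> = ?e * ?X 0"
    by (simp only: prod.distrib) (simp add: exp_of_nat_mult[symmetric] algebra_simps)
  finally have "?X h \<le> ?e * ?X 0" .
  moreover have "1 * (real s - 1) \<le> ?e * (real s - 1)"
    using s h by (intro mult_right_mono) auto
  ultimately have "?X h + (real s - 1) \<le> ?e * (?X 0 + (real s - 1))" by (simp add: distrib_left)
  then have "(?X h + (real s - 1)) / s \<le> ?e * (?X 0 + (real s - 1)) / s"
    by (intro divide_right_mono) auto
  then show ?case by (simp add: add_diff_eq)
qed (simp add: exp_add exp_diff mult.commute)

lemma partition_fun_hierarchical_iid:
  assumes P: "prob_space P" and s: "2 \<le> s"
    and ind: "prob_space.indep_vars P (\<lambda>_. borel) \<omega> UNIV"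
    and iid: "\<And>i. distr P borel (\<omega> i) = distr P borel (\<omega> 0)"
    and int: "\<And>b. b > 0 \<Longrightarrow> integrable P (\<lambda>x. exp (b * \<omega> 1 x))"
    and \<beta>: "0 \<le> \<beta>"
  shows "hierarchical_iid P s (partition_fun P \<omega> s \<beta> h)"
    and "hierarchical_iid.mean P (partition_fun P \<omega> s \<beta> h) 0 = exp h"
proof -
  interpret prob_space P by fact
  define m where "m = ln (exp_moment P \<omega> \<beta>)"
  have [measurable]: "random_variable borel (\<omega> i)" for i using ind by (auto simp: indep_vars_def)
  have distr_eq: "distr P borel (\<lambda>x. f (\<omega> i x)) = distr (distr P borel (\<omega> i)) borel f"
    if "f \<in> borel_measurable borel" for f :: "real \<Rightarrow> real" and i
    using that by (simp add: distr_distr comp_def)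
  have int0: "integrable P (\<lambda>x. exp (b * \<omega> i x))"
    and E0: "expectation (\<lambda>x. exp (b * \<omega> i x)) = exp_moment P \<omega> b" if b: "0 \<le> b" for b i
  proof -
    have *: "distr P borel (\<omega> i) = distr P borel (\<omega> 1)" using iid[of i] iid[of 1] by simp
    have i1: "integrable P (\<lambda>x. exp (b * \<omega> 1 x))" using int[of b] b by (cases "b = 0") auto
    have "integrable (distr P borel (\<omega> i)) (\<lambda>y. exp (b * y))"
      unfolding * using i1 by (subst integrable_distr_eq) auto
    then show "integrable P (\<lambda>x. exp (b * \<omega> i x))" by (subst (asm) integrable_distr_eq) auto
    have "expectation (\<lambda>x. exp (b * \<omega> i x)) = (\<integral>y. exp (b * y) \<partial>distr P borel (\<omega> i))"
      by (subst integral_distr) auto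
    also have "\<dots> = exp_moment P \<omega> b" unfolding * exp_moment_def by (subst integral_distr) auto
    finally show "expectation (\<lambda>x. exp (b * \<omega> i x)) = exp_moment P \<omega> b" .
  qed
  have M: "0 < exp_moment P \<omega> \<beta>"
    using integral_less_AE_space[of "\<lambda>_. 0" "\<lambda>x. exp (\<beta> * \<omega> 1 x)"] int0[OF \<beta>, of 1]
    by (simp add: emeasure_space_1 exp_moment_def)
  have R0: "partition_fun P \<omega> s \<beta> h 0 = (\<lambda>i x. exp (\<beta> * \<omega> i x + h - m))"
    by (simp add: fun_eq_iff m_def)
  show H: "hierarchical_iid P s (partition_fun P \<omega> s \<beta> h)"
  proof
    show "2 \<le> s" by fact
    show "indep_vars (\<lambda>_. borel) (partition_fun P \<omega> s \<beta> h 0) UNIV"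
      using indep_vars_compose2[OF ind, of "\<lambda>_ y. exp (\<beta> * y + h - m)" "\<lambda>_. borel"]
      unfolding R0 by simp
    show "distr P borel (partition_fun P \<omega> s \<beta> h 0 i) = distr P borel (partition_fun P \<omega> s \<beta> h 0 0)" for i
      using distr_eq[of "\<lambda>y. exp (\<beta> * y + h - m)" i] distr_eq[of "\<lambda>y. exp (\<beta> * y + h - m)" 0] iid[of i]
      unfolding R0 by simp
    \<comment> \<open>Square integrability of the starting values is the exponential moment at
      \<open>2 * \<beta>\<close>.\<close>
    have "(partition_fun P \<omega> s \<beta> h 0 0 x)\<^sup>2 = exp (2 * (h - m)) * exp (2 * \<beta> * \<omega> 0 x)" for x
      by (simp add: m_def power2_eq_square exp_add[symmetric] algebra_simps)
    then show "integrable P (\<lambda>x. (partition_fun P \<omega> s \<beta> h 0 0 x)\<^sup>2)"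
      using int0[of "2 * \<beta>" 0] \<beta> by simp
  qed auto
  then interpret H: hierarchical_iid P s "partition_fun P \<omega> s \<beta> h" .
  have "H.mean 0 = expectation (\<lambda>x. exp (h - m) * exp (\<beta> * \<omega> 0 x))"
    unfolding H.mean_def R0 by (simp add: exp_add[symmetric] algebra_simps)
  also have "\<dots> = exp (h - m) * exp_moment P \<omega> \<beta>" using E0[OF \<beta>, of 0] by simp
  also have "\<dots> = exp h" using M by (simp add: m_def exp_diff)
  finally show "H.mean 0 = exp h" .
qed

lemma free_energy_pos_iff:
  assumes P: "prob_space P" and s: "2 \<le> s"
    and ind: "prob_space.indep_vars P (\<lambda>_. borel) \<omega> UNIV"
    and iid: "\<And>i. distr P borel (\<omega> i) = distr P borel (\<omega> 0)"
    and int: "\<And>b. b > 0 \<Longrightarrow> integrable P (\<lambda>x. exp (b * \<omega> 1 x))"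
    and \<beta>: "0 \<le> \<beta>"
  shows "0 < free_energy P \<omega> s \<beta> h \<longleftrightarrow> 0 < h"
proof -
  note hyps = P s ind iid int \<beta>
  let ?R = "partition_fun P \<omega> s \<beta>"
  interpret H: hierarchical_iid P s "?R k" for k
    by (rule partition_fun_hierarchical_iid(1)[OF hyps])
  have mean0: "H.mean h 0 = exp h" for h
    by (rule partition_fun_hierarchical_iid(2)[OF hyps])
  have "free_energy P \<omega> s \<beta> h = 0" if "h \<le> 0"
  proof -
    have "H.mean h 0 \<le> 1" using that by (simp add: mean0)
    from H.free_energy_eq[OF H.free_energy_subcritical[OF this], of 1]
    show ?thesis by (simp add: free_energy_def)
  qed
  moreover have "0 < free_energy P \<omega> s \<beta> h" if h: "0 < h"
  proof -
    have mean00: "H.mean 0 0 = 1" by (simp add: mean0)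
    obtain p where p: "1 < p" "p \<le> 2" and small: "\<And>\<epsilon>. 0 < \<epsilon> \<Longrightarrow> \<exists>n. H.dev 0 p n < \<epsilon>"
      using H.dev_small[OF mean00] by blast
    define \<delta> where "\<delta> = ((1/2) powr p - 1 + p / 2) / 2"
    have "0 < \<delta>" using powr_deviation_half_pos[OF p(1)] by (simp add: \<delta>_def)
    from deviation_stays_small[OF s p(1) this, of "4 * (real s)\<^sup>2"]
    obtain \<epsilon> where \<epsilon>: "0 < \<epsilon>" and stays: "\<And>r D. \<lbrakk>1 < r 0; D 0 \<le> \<epsilon>; \<forall>m. 0 \<le> D m;
        \<forall>m. r (Suc m) = (r m ^ s + real s - 1) / real s;
        \<forall>m. D (Suc m) \<le> (r m ^ s / (r m ^ s + real s - 1)) powr p * ((1 + D m) ^ s - 1)\<rbrakk>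
        \<Longrightarrow> \<exists>N>0. 4 * (real s)\<^sup>2 < r N \<and> D N < \<delta>"
      by blast
    obtain n where n: "H.dev 0 p n < \<epsilon>" using small[OF \<epsilon>] by blast
    have dev0: "0 \<le> H.dev 0 p n" by (rule H.dev_nonneg[OF p])
    \<comment> \<open>Chosen so that
      \<open>exp (p * (l * s ^ n)) * (1 + H.dev 0 p n) = 1 + \<epsilon>\<close>: up to
      \<open>l\<close>, the deviation in generation \<open>n\<close> stays within
      \<open>\<epsilon>\<close>.\<close>
    define l where "l = ln ((1 + \<epsilon>) / (1 + H.dev 0 p n)) / (p * s ^ n)"
    have "0 < l" unfolding l_def using n dev0 p s by (intro divide_pos_pos) auto
    \<comment> \<open>The argument is run at a possibly smaller \<open>h'\<close>; monotonicity of
      the partition function brings the result back to \<open>h\<close>.\<close>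
    define h' where "h' = min h l"
    have h': "0 < h'" "h' \<le> h" "h' \<le> l" using h \<open>0 < l\<close> by (auto simp: h'_def)
    have mean_gt: "1 < H.mean h' m" for m
    proof (induction m)
      case 0
      then show ?case using h' by (simp add: mean0)
    next
      case (Suc m)
      then have "1 < H.mean h' m ^ s" using s by (intro one_less_power) auto
      then show ?case using s by (simp add: H.mean_Suc less_divide_eq)
    qed
    have "H.dev h' p n \<le> \<epsilon>"
    proof -
      let ?E = "\<lambda>h. \<integral>x. ?R h n 0 x powr p \<partial>P"
      have intp: "integrable P (\<lambda>x. ?R h n 0 x powr p)" for h using p by (intro H.integrable_powr) auto
      have E1: "?E 0 = 1 + H.dev 0 p n" by (simp add: H.dev_def H.mean_eq_1[OF mean00])
      have "?E h' \<le> (\<integral>x. exp (p * (h' * s ^ n)) * ?R 0 n 0 x powr p \<partial>P)"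
      proof (rule integral_mono[OF intp])
        show "integrable P (\<lambda>x. exp (p * (h' * s ^ n)) * ?R 0 n 0 x powr p)" using intp by simp
        fix x
        have "?R h' n 0 x powr p \<le> (exp (h' * s ^ n) * ?R 0 n 0 x) powr p"
          using partition_fun_le[of s h'] s h' p by (intro powr_mono2) auto
        also have "\<dots> = exp (p * (h' * s ^ n)) * ?R 0 n 0 x powr p"
          by (simp add: powr_mult powr_def[of "exp _"])
        finally show "?R h' n 0 x powr p \<le> exp (p * (h' * s ^ n)) * ?R 0 n 0 x powr p" .
      qed
      also have "\<dots> = exp (p * (h' * s ^ n)) * (1 + H.dev 0 p n)" by (simp add: E1)
      also have "\<dots> \<le> (1 + \<epsilon>) / (1 + H.dev 0 p n) * (1 + H.dev 0 p n)"
      proof (intro mult_right_mono)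
        have "h' * (p * s ^ n) \<le> l * (p * s ^ n)" using h' p by (intro mult_right_mono) auto
        also have "\<dots> = ln ((1 + \<epsilon>) / (1 + H.dev 0 p n))" using p s by (simp add: l_def)
        finally have "exp (p * (h' * s ^ n)) \<le> exp (ln ((1 + \<epsilon>) / (1 + H.dev 0 p n)))"
          by (simp add: mult.commute mult.left_commute)
        then show "exp (p * (h' * s ^ n)) \<le> (1 + \<epsilon>) / (1 + H.dev 0 p n)"
          using \<epsilon> dev0 by (subst (asm) exp_ln) (auto intro!: divide_pos_pos)
      qed (use dev0 in auto)
      also have "\<dots> = 1 + \<epsilon>" using dev0 by simp
      finally have "?E h' \<le> 1 + \<epsilon>" .
      moreover have "?E h' / H.mean h' n powr p \<le> ?E h' / 1"
        using mean_gt[of n] p by (intro divide_left_mono) (auto simp: ge_one_powr_ge_zero)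
      ultimately show ?thesis by (simp add: H.dev_def)
    qed
    \<comment> \<open>The scalar recursion is started at generation \<open>n\<close>, with both
      sequences shifted.\<close>
    then have "\<exists>N>0. 4 * (real s)\<^sup>2 < H.mean h' (n + N) \<and> H.dev h' p (n + N) < \<delta>"
      using stays[of "\<lambda>m. H.mean h' (n + m)" "\<lambda>m. H.dev h' p (n + m)"] mean_gt
        H.dev_nonneg[OF p] H.dev_Suc[OF p] H.mean_Suc by simp
    then obtain N where N: "1 \<le> N" "4 * (real s)\<^sup>2 < H.mean h' N" "H.dev h' p N < \<delta>"
      by (metis One_nat_def Suc_leI add_gr_0)
    have "ln s < H.mean_ln h' N" using H.mean_ln_large[OF p N(1,2)] N(3) by (simp add: \<delta>_def)
    also have "\<dots> \<le> H.mean_ln h N"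
      unfolding H.mean_ln_def
    proof (rule integral_mono[OF H.integrable_clip_ln H.integrable_clip_ln])
      show "clip_ln (?R h' N 0 x) \<le> clip_ln (?R h N 0 x)" for x
        unfolding H.clip_ln_R[OF N(1)] using partition_fun_mono[of s h' h] s h' by simp
    qed
    finally have L: "ln s < H.mean_ln h N" .
    obtain F where F: "(\<lambda>n. H.mean_ln h n / s ^ n) \<longlonglongrightarrow> F"
        "\<forall>n\<ge>1. (H.mean_ln h n - ln s) / s ^ n \<le> F"
      using H.mean_ln_limit[of h] by blast
    have "0 < (H.mean_ln h N - ln s) / s ^ N" using L s by (intro divide_pos_pos) auto
    then have "0 < F" using F(2) N(1) by fastforce
    moreover have "free_energy P \<omega> s \<beta> h = F"
      using H.free_energy_eq[OF F(1), of 1] by (simp add: free_energy_def)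
    ultimately show ?thesis by simp
  qed
  ultimately show ?thesis by (cases "0 < h") auto
qed

theorem theorem2p3:
  fixes P :: "'a measure" and \<omega> :: "nat \<Rightarrow> 'a \<Rightarrow> real" and s :: nat and \<beta> :: real
  assumes "prob_space P"
    and "s \<ge> 2"
    and "prob_space.indep_vars P (\<lambda>_. borel) \<omega> UNIV"
    and "\<And>i. distr P borel (\<omega> i) = distr P borel (\<omega> 0)"
    and "\<And>b. b > 0 \<Longrightarrow> integrable P (\<lambda>x. exp (b * \<omega> 1 x))"
    and "\<beta> > 0"
  shows "critical_point P \<omega> s \<beta> = critical_point P \<omega> s 0 \<and> critical_point P \<omega> s 0 = 0"
proof -
  have "critical_point P \<omega> s b = 0" if "0 \<le> b" for b
  proof -
    \<comment> \<open>The case \<open>b = 0\<close> is included, so both critical points are the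
      infimum of the positive half-line.\<close>
    have "{h. 0 < free_energy P \<omega> s b h} = {0<..}"
      using free_energy_pos_iff[OF assms(1-5) that] by auto
    then show ?thesis by (simp add: critical_point_def)
  qed
  then show ?thesis using \<open>\<beta> > 0\<close> by simp
qed

end
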